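(* Let $(M,g)$ be a Riemannian manifold, let $G$ be a Lie group with Lie algebra $\mathfrak{g}$, endowed with a left invariant connection $\nabla^{G}$ whose connection function $\alpha:\mathfrak{g}\otimes\mathfrak{g}\to\mathfrak{g}$ is skew-symmetric, let $\omega_{G}$ be the ($\mathfrak{g}$-valued) Maurer-Cartan form on $G$, and let $F:M\to G$ be a smooth map. Then $F$ is harmonic if and only if $$d^{*}F^{*}\omega_{G}=0,$$ where $d^{*}$ is the co-differential operator on $M$.
   Context: Smooth means $C^\infty$; $M$ and $G$ are finite-dimensional. Elements of $\mathfrak{g}$ are identified with left invariant vector fields on $G$. Connection function: a left invariant (affine) connection $\nabla^{G}$ on $G$ corresponds to the bilinear map $\alpha:\mathfrak{g}\otimes\mathfrak{g}\to\mathfrak{g}$ given by $\nabla^{G}_XY=\alpha(X,Y)$ for all $X,Y\in\mathfrak{g}$; $\alpha$ is called its connection function. Skew-symmetric means $\alpha(X,Y)=-\alpha(Y,X)$. No metric on $G$ is assumed. Maurer-Cartan form: $\omega_G(v)=L_{h^{-1}*}v\in T_eG=\mathfrak{g}$ for $v\in T_hG$, where $L_h$ is left translation by $h$. Harmonic maps: let $\nabla^{M}$ be the Levi-Civita connection of $g$, and let $\nabla^{G\prime}$ be the connection induced by $\nabla^{G}$ on the pull-back bundle $F^{-1}(TG)$. The second fundamental form of $F$ is $\beta_F(X,Y)=\nabla^{G\prime}_X F_*(Y)-F_*(\nabla^{M}_XY)$ for vector fields $X,Y$ on $M$. The tension field is $\tau_F=\mathrm{tr}\,\beta_F$ (trace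 with respect to $g$), and $F$ is called harmonic if $\tau_F\equiv 0$. Co-differential: for a (real-valued or $\mathfrak{g}$-valued) 1-form $\eta$ on $M$, $d^{*}\eta=-\sum_{i}(\nabla^{M}_{e_i}\eta)(e_i)=-\sum_i\big(e_i(\eta(e_i))-\eta(\nabla^{M}_{e_i}e_i)\big)$ for any local orthonormal frame $\{e_1,\dots,e_n\}$ on $M$, where $\mathfrak{g}$-valued functions are differentiated as functions with values in a vector space. *)

theory Defs
  imports "HOL-Analysis.Analysis"
begin

section \<open>Smooth functions on open subsets of a finite-dimensional inner product space\<close>

text \<open>In finite dimension, \<open>C\<^sup>k\<^sup>+\<^sup>1\<close> means differentiable with all directional derivatives of
  class \<open>C\<^sup>k\<close>.  Model spaces have sort \<open>real_inner\<close>, with finite dimension as a separate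
  assumption, because sort \<open>euclidean_space\<close> would exclude dimension \<open>0\<close>.\<close>

primrec Ck_on :: "nat \<Rightarrow> 'a::real_normed_vector set \<Rightarrow> ('a \<Rightarrow> 'b::real_normed_vector) \<Rightarrow> bool" where
  "Ck_on 0 S f \<longleftrightarrow> continuous_on S f"
| "Ck_on (Suc k) S f \<longleftrightarrow> (\<forall>x\<in>S. f differentiable (at x)) \<and>
     (\<forall>v. Ck_on k S (\<lambda>x. frechet_derivative f (at x) v))"

definition smooth_on :: "'a::real_normed_vector set \<Rightarrow> ('a \<Rightarrow> 'b::real_normed_vector) \<Rightarrow> bool" where
  "smooth_on S f \<longleftrightarrow> (\<forall>k. Ck_on k S f)"


section \<open>Smooth manifolds\<close>

text \<open>A chart is a pair of a domain and a coordinate map; only the values of the coordinate map on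
  the domain matter.\<close>

type_synonym ('m, 'a) atlas = "('m set \<times> ('m \<Rightarrow> 'a)) set"

locale smooth_manifold =
  fixes A :: "('m::{t2_space,second_countable_topology}, 'a::real_inner) atlas"
  assumes finite_dimensional: "\<exists>E::'a set. finite E \<and> span E = UNIV"
    and covers: "(\<Union>(U, \<phi>)\<in>A. U) = UNIV"
    and chart: "(U, \<phi>) \<in> A \<Longrightarrow> open U \<and> open (\<phi> ` U) \<and> inj_on \<phi> U \<and>
      continuous_on U \<phi> \<and> continuous_on (\<phi> ` U) (inv_into U \<phi>)"
    and compatible: "(U, \<phi>) \<in> A \<Longrightarrow> (V, \<psi>) \<in> A \<Longrightarrow> smooth_on (\<phi> ` (U \<inter> V)) (\<psi> \<circ> inv_into U \<phi>)"

definition smooth_map_on ::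
  "('m::topological_space, 'a::real_inner) atlas \<Rightarrow> ('n::topological_space, 'b::real_inner) atlas \<Rightarrow>
    'm set \<Rightarrow> ('m \<Rightarrow> 'n) \<Rightarrow> bool" where
  "smooth_map_on A B W F \<longleftrightarrow> open W \<and> continuous_on W F \<and>
    (\<forall>(U, \<phi>)\<in>A. \<forall>(V, \<psi>)\<in>B. smooth_on (\<phi> ` (W \<inter> U \<inter> F -` V)) (\<psi> \<circ> F \<circ> inv_into U \<phi>))"

definition std_atlas :: "('a::real_inner, 'a) atlas" where
  "std_atlas = {(UNIV, id)}"

definition product_atlas ::
  "('m, 'a) atlas \<Rightarrow> ('n, 'b) atlas \<Rightarrow> ('m \<times> 'n, 'a \<times> 'b) atlas" where
  "product_atlas A B = {(U \<times> V, map_prod \<phi> \<psi>) | U \<phi> V \<psi>. (U, \<phi>) \<in> A \<and> (V, \<psi>) \<in> B}"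

abbreviation smooth_fun :: "('m::topological_space, 'a::real_inner) atlas \<Rightarrow> 'm set \<Rightarrow> ('m \<Rightarrow> real) \<Rightarrow> bool" where
  "smooth_fun A W f \<equiv> smooth_map_on A std_atlas W f"

definition smooth_near :: "('m::topological_space, 'a::real_inner) atlas \<Rightarrow> 'm \<Rightarrow> ('m \<Rightarrow> real) \<Rightarrow> bool" where
  "smooth_near A p f \<longleftrightarrow> (\<exists>U. p \<in> U \<and> smooth_fun A U f)"


section \<open>Tangent vectors and vector fields along a map\<close>

text \<open>Tangent vectors at \<open>p\<close> are the derivations \<open>f \<mapsto> (f \<circ> c)' 0\<close> given by smooth curves \<open>c\<close> with
  \<open>c 0 = p\<close>.  They act on real functions smooth near \<open>p\<close> and are set to \<open>0\<close> on all others, so that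
  equal tangent vectors are equal as functions.  The vector space operations are pointwise.\<close>

type_synonym 'm tvec = "('m \<Rightarrow> real) \<Rightarrow> real"

definition velocity :: "('m::topological_space, 'a::real_inner) atlas \<Rightarrow> (real \<Rightarrow> 'm) \<Rightarrow> 'm tvec" where
  "velocity A c = (\<lambda>f. if smooth_near A (c 0) f then deriv (f \<circ> c) 0 else 0)"

definition tangent_space :: "('m::topological_space, 'a::real_inner) atlas \<Rightarrow> 'm \<Rightarrow> 'm tvec set" where
  "tangent_space A p = {velocity A c | c I. 0 \<in> I \<and> smooth_map_on std_atlas A I c \<and> c 0 = p}"

definition pushforward ::
  "('n::topological_space, 'b::real_inner) atlas \<Rightarrow> ('m \<Rightarrow> 'n) \<Rightarrow> 'm \<Rightarrow> 'm tvec \<Rightarrow> 'n tvec" where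
  "pushforward B F p v = (\<lambda>f. if smooth_near B (F p) f then v (f \<circ> F) else 0)"

text \<open>Smooth sections over \<open>U\<close> of the pull-back bundle \<open>F\<^sup>-\<^sup>1(TN)\<close>, for \<open>F : M \<rightarrow> N\<close>.
  Vector fields on \<open>M\<close> are the case \<open>F = id\<close>.\<close>

definition field_along ::
  "('m::topological_space, 'a::real_inner) atlas \<Rightarrow> ('n::topological_space, 'b::real_inner) atlas \<Rightarrow>
    ('m \<Rightarrow> 'n) \<Rightarrow> 'm set \<Rightarrow> ('m \<Rightarrow> 'n tvec) \<Rightarrow> bool" where
  "field_along A B F U Z \<longleftrightarrow> open U \<and> (\<forall>p\<in>U. Z p \<in> tangent_space B (F p)) \<and>
    (\<forall>W f. smooth_fun B W f \<longrightarrow> smooth_fun A (U \<inter> F -` W) (\<lambda>p. Z p f))"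

abbreviation vector_field :: "('m::topological_space, 'a::real_inner) atlas \<Rightarrow> 'm set \<Rightarrow> ('m \<Rightarrow> 'm tvec) \<Rightarrow> bool" where
  "vector_field A U X \<equiv> field_along A A id U X"

definition lie_bracket ::
  "('m::topological_space, 'a::real_inner) atlas \<Rightarrow> ('m \<Rightarrow> 'm tvec) \<Rightarrow> ('m \<Rightarrow> 'm tvec) \<Rightarrow> 'm \<Rightarrow> 'm tvec" where
  "lie_bracket A X Y p =
    (\<lambda>f. if smooth_near A p f then X p (\<lambda>q. Y q f) - Y p (\<lambda>q. X q f) else 0)"


section \<open>Connections\<close>

text \<open>A connection on \<open>F\<^sup>-\<^sup>1(TN)\<close>, regarded as acting on fields over arbitrary open subsets of \<open>M\<close>
  compatibly with restriction.  Fields are total functions whose values outside the open set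
  under consideration are irrelevant: this is what \<open>local\<close> says.\<close>

locale connection_along =
  fixes A :: "('m::topological_space, 'a::real_inner) atlas"
    and B :: "('n::topological_space, 'b::real_inner) atlas"
    and F :: "'m \<Rightarrow> 'n"
    and D :: "('m \<Rightarrow> 'm tvec) \<Rightarrow> ('m \<Rightarrow> 'n tvec) \<Rightarrow> 'm \<Rightarrow> 'n tvec"
  assumes smooth: "vector_field A U X \<Longrightarrow> field_along A B F U Z \<Longrightarrow> field_along A B F U (D X Z)"
    and local: "vector_field A U X \<Longrightarrow> field_along A B F U Z \<Longrightarrow>
      \<forall>q\<in>U. X' q = X q \<Longrightarrow> \<forall>q\<in>U. Z' q = Z q \<Longrightarrow> p \<in> U \<Longrightarrow> D X' Z' p = D X Z p"
    and add_left: "vector_field A U X \<Longrightarrow> vector_field A U Y \<Longrightarrow> field_along A B F U Z \<Longrightarrow> p \<in> U \<Longrightarrow>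
      D (\<lambda>q f. X q f + Y q f) Z p = (\<lambda>f. D X Z p f + D Y Z p f)"
    and scale_left: "vector_field A U X \<Longrightarrow> field_along A B F U Z \<Longrightarrow> smooth_fun A U u \<Longrightarrow> p \<in> U \<Longrightarrow>
      D (\<lambda>q f. u q * X q f) Z p = (\<lambda>f. u p * D X Z p f)"
    and add_right: "vector_field A U X \<Longrightarrow> field_along A B F U Z \<Longrightarrow> field_along A B F U Z' \<Longrightarrow> p \<in> U \<Longrightarrow>
      D X (\<lambda>q f. Z q f + Z' q f) p = (\<lambda>f. D X Z p f + D X Z' p f)"
    and leibniz: "vector_field A U X \<Longrightarrow> field_along A B F U Z \<Longrightarrow> smooth_fun A U u \<Longrightarrow> p \<in> U \<Longrightarrow>
      D X (\<lambda>q f. u q * Z q f) p = (\<lambda>f. X p u * Z p f + u p * D X Z p f)"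

abbreviation affine_connection ::
  "('m::topological_space, 'a::real_inner) atlas \<Rightarrow>
    (('m \<Rightarrow> 'm tvec) \<Rightarrow> ('m \<Rightarrow> 'm tvec) \<Rightarrow> 'm \<Rightarrow> 'm tvec) \<Rightarrow> bool" where
  "affine_connection A D \<equiv> connection_along A A id D"

text \<open>The connection induced by \<open>\<nabla>\<close> on \<open>F\<^sup>-\<^sup>1(TN)\<close> is the connection characterised by
  \<open>\<nabla>'\<^sub>X (Y \<circ> F) = \<nabla>\<^sub>F\<^sub>*\<^sub>X Y\<close>.  Since \<open>F\<^sub>*X\<close> is no vector field on \<open>N\<close>, its value at \<open>p\<close> is
  extended to a local vector field \<open>V\<close>; the value of \<open>\<nabla>\<^sub>V Y\<close> at \<open>F p\<close> does not depend on the
  extension.\<close>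

locale pullback_connection = connection_along A B F D
  for A :: "('m::topological_space, 'a::real_inner) atlas"
    and B :: "('n::topological_space, 'b::real_inner) atlas"
    and F :: "'m \<Rightarrow> 'n"
    and D :: "('m \<Rightarrow> 'm tvec) \<Rightarrow> ('m \<Rightarrow> 'n tvec) \<Rightarrow> 'm \<Rightarrow> 'n tvec" +
  fixes nabla :: "('n \<Rightarrow> 'n tvec) \<Rightarrow> ('n \<Rightarrow> 'n tvec) \<Rightarrow> 'n \<Rightarrow> 'n tvec"
  assumes induced: "vector_field A U X \<Longrightarrow> p \<in> U \<Longrightarrow> vector_field B W Y \<Longrightarrow> F p \<in> W \<Longrightarrow>
      vector_field B W V \<Longrightarrow> V (F p) = pushforward B F p (X p) \<Longrightarrow>
      D X (Y \<circ> F) p = nabla V Y (F p)"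


section \<open>Riemannian manifolds\<close>

locale riemannian_manifold = smooth_manifold A
  for A :: "('m::{t2_space,second_countable_topology}, 'a::real_inner) atlas" +
  fixes g :: "'m \<Rightarrow> 'm tvec \<Rightarrow> 'm tvec \<Rightarrow> real"
  assumes sym: "v \<in> tangent_space A p \<Longrightarrow> w \<in> tangent_space A p \<Longrightarrow> g p v w = g p w v"
    and add: "v \<in> tangent_space A p \<Longrightarrow> v' \<in> tangent_space A p \<Longrightarrow> w \<in> tangent_space A p \<Longrightarrow>
      g p (\<lambda>f. v f + v' f) w = g p v w + g p v' w"
    and scale: "v \<in> tangent_space A p \<Longrightarrow> w \<in> tangent_space A p \<Longrightarrow>
      g p (\<lambda>f. r * v f) w = r * g p v w"
    and pos: "v \<in> tangent_space A p \<Longrightarrow> v \<noteq> (\<lambda>_. 0) \<Longrightarrow> g p v v > 0"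
    and smooth: "vector_field A U X \<Longrightarrow> vector_field A U Y \<Longrightarrow> smooth_fun A U (\<lambda>p. g p (X p) (Y p))"

locale levi_civita = connection_along A A id D
  for A :: "('m::topological_space, 'a::real_inner) atlas"
    and g :: "'m \<Rightarrow> 'm tvec \<Rightarrow> 'm tvec \<Rightarrow> real"
    and D :: "('m \<Rightarrow> 'm tvec) \<Rightarrow> ('m \<Rightarrow> 'm tvec) \<Rightarrow> 'm \<Rightarrow> 'm tvec" +
  assumes torsion_free: "vector_field A U X \<Longrightarrow> vector_field A U Y \<Longrightarrow> p \<in> U \<Longrightarrow>
      (\<lambda>f. D X Y p f - D Y X p f) = lie_bracket A X Y p"
    and metric: "vector_field A U X \<Longrightarrow> vector_field A U Y \<Longrightarrow> vector_field A U Z \<Longrightarrow> p \<in> U \<Longrightarrow>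
      X p (\<lambda>q. g q (Y q) (Z q)) = g p (D X Y p) (Z p) + g p (Y p) (D X Z p)"

definition orthonormal_frame ::
  "('m::topological_space, 'a::real_inner) atlas \<Rightarrow> ('m \<Rightarrow> 'm tvec \<Rightarrow> 'm tvec \<Rightarrow> real) \<Rightarrow> 'm set \<Rightarrow>
    (nat \<Rightarrow> 'm \<Rightarrow> 'm tvec) \<Rightarrow> bool" where
  "orthonormal_frame A g U e \<longleftrightarrow>
    (\<forall>i < dim (UNIV :: 'a set). vector_field A U (e i)) \<and>
    (\<forall>p\<in>U. \<forall>i < dim (UNIV :: 'a set). \<forall>j < dim (UNIV :: 'a set).
       g p (e i p) (e j p) = (if i = j then 1 else 0))"

text \<open>Traces and the co-differential are computed in a local orthonormal frame defined near the
  point in question; they do not depend on the frame that is chosen here.\<close>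

definition frame_near ::
  "('m::topological_space, 'a::real_inner) atlas \<Rightarrow> ('m \<Rightarrow> 'm tvec \<Rightarrow> 'm tvec \<Rightarrow> real) \<Rightarrow> 'm \<Rightarrow>
    nat \<Rightarrow> 'm \<Rightarrow> 'm tvec" where
  "frame_near A g p = (SOME e. \<exists>U. open U \<and> p \<in> U \<and> orthonormal_frame A g U e)"

text \<open>A 1-form takes a point \<open>p\<close> and a tangent vector at \<open>p\<close>; its values lie in a fixed tangent
  space of \<open>N\<close>, here the Lie algebra.  A function \<open>u\<close> from \<open>M\<close> to this finite-dimensional vector
  space is differentiated through the linear functionals \<open>x \<mapsto> x f\<close>, which separate its points:
  the derivative of \<open>u\<close> along \<open>v\<close> is \<open>\<lambda>f. v (\<lambda>q. u q f)\<close>.\<close>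

definition codifferential ::
  "('m::topological_space, 'a::real_inner) atlas \<Rightarrow> ('m \<Rightarrow> 'm tvec \<Rightarrow> 'm tvec \<Rightarrow> real) \<Rightarrow>
    (('m \<Rightarrow> 'm tvec) \<Rightarrow> ('m \<Rightarrow> 'm tvec) \<Rightarrow> 'm \<Rightarrow> 'm tvec) \<Rightarrow> ('m \<Rightarrow> 'm tvec \<Rightarrow> 'n tvec) \<Rightarrow>
    'm \<Rightarrow> 'n tvec" where
  "codifferential A g nablaM \<eta> p = (let e = frame_near A g p in
    (\<lambda>f. - (\<Sum>i < dim (UNIV :: 'a set).
        e i p (\<lambda>q. \<eta> q (e i q) f) - \<eta> p (nablaM (e i) (e i) p) f)))"


section \<open>Harmonic maps\<close>

definition second_fundamental_form ::
  "('n::topological_space, 'b::real_inner) atlas \<Rightarrow> ('m \<Rightarrow> 'n) \<Rightarrow>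
    (('m \<Rightarrow> 'm tvec) \<Rightarrow> ('m \<Rightarrow> 'm tvec) \<Rightarrow> 'm \<Rightarrow> 'm tvec) \<Rightarrow>
    (('m \<Rightarrow> 'm tvec) \<Rightarrow> ('m \<Rightarrow> 'n tvec) \<Rightarrow> 'm \<Rightarrow> 'n tvec) \<Rightarrow>
    ('m \<Rightarrow> 'm tvec) \<Rightarrow> ('m \<Rightarrow> 'm tvec) \<Rightarrow> 'm \<Rightarrow> 'n tvec" where
  "second_fundamental_form B F nablaM D X Y p =
    (\<lambda>f. D X (\<lambda>q. pushforward B F q (Y q)) p f - pushforward B F p (nablaM X Y p) f)"

definition tension_field ::
  "('m::topological_space, 'a::real_inner) atlas \<Rightarrow> ('n::topological_space, 'b::real_inner) atlas \<Rightarrow>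
    ('m \<Rightarrow> 'm tvec \<Rightarrow> 'm tvec \<Rightarrow> real) \<Rightarrow> ('m \<Rightarrow> 'n) \<Rightarrow>
    (('m \<Rightarrow> 'm tvec) \<Rightarrow> ('m \<Rightarrow> 'm tvec) \<Rightarrow> 'm \<Rightarrow> 'm tvec) \<Rightarrow>
    (('m \<Rightarrow> 'm tvec) \<Rightarrow> ('m \<Rightarrow> 'n tvec) \<Rightarrow> 'm \<Rightarrow> 'n tvec) \<Rightarrow> 'm \<Rightarrow> 'n tvec" where
  "tension_field A B g F nablaM D p = (let e = frame_near A g p in
    (\<lambda>f. \<Sum>i < dim (UNIV :: 'a set). second_fundamental_form B F nablaM D (e i) (e i) p f))"

definition harmonic ::
  "('m::topological_space, 'a::real_inner) atlas \<Rightarrow> ('n::topological_space, 'b::real_inner) atlas \<Rightarrow>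
    ('m \<Rightarrow> 'm tvec \<Rightarrow> 'm tvec \<Rightarrow> real) \<Rightarrow> ('m \<Rightarrow> 'n) \<Rightarrow>
    (('m \<Rightarrow> 'm tvec) \<Rightarrow> ('m \<Rightarrow> 'm tvec) \<Rightarrow> 'm \<Rightarrow> 'm tvec) \<Rightarrow>
    (('m \<Rightarrow> 'm tvec) \<Rightarrow> ('m \<Rightarrow> 'n tvec) \<Rightarrow> 'm \<Rightarrow> 'n tvec) \<Rightarrow> bool" where
  "harmonic A B g F nablaM D \<longleftrightarrow> (\<forall>p. tension_field A B g F nablaM D p = (\<lambda>_. 0))"


section \<open>Lie groups\<close>

locale lie_group = smooth_manifold B + group mul one iv
  for B :: "('n::{t2_space,second_countable_topology}, 'b::real_inner) atlas"
    and mul :: "'n \<Rightarrow> 'n \<Rightarrow> 'n" and one :: 'n and iv :: "'n \<Rightarrow> 'n" +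
  assumes smooth_mul: "smooth_map_on (product_atlas B B) B UNIV (\<lambda>(x, y). mul x y)"
    and smooth_iv: "smooth_map_on B B UNIV iv"

text \<open>\<open>(L\<^sub>h)\<^sub>* X\<close> as a vector field: its value at \<open>k\<close> is the push-forward of the value of \<open>X\<close> at
  \<open>h\<^sup>-\<^sup>1k\<close>.\<close>

definition left_translate ::
  "('n::topological_space, 'b::real_inner) atlas \<Rightarrow> ('n \<Rightarrow> 'n \<Rightarrow> 'n) \<Rightarrow> ('n \<Rightarrow> 'n) \<Rightarrow> 'n \<Rightarrow>
    ('n \<Rightarrow> 'n tvec) \<Rightarrow> 'n \<Rightarrow> 'n tvec" where
  "left_translate B mul iv h X k = pushforward B (mul h) (mul (iv h) k) (X (mul (iv h) k))"

locale left_invariant_connection = connection_along B B id nabla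
  for B :: "('n::topological_space, 'b::real_inner) atlas"
    and mul :: "'n \<Rightarrow> 'n \<Rightarrow> 'n" and iv :: "'n \<Rightarrow> 'n"
    and nabla :: "('n \<Rightarrow> 'n tvec) \<Rightarrow> ('n \<Rightarrow> 'n tvec) \<Rightarrow> 'n \<Rightarrow> 'n tvec" +
  assumes left_invariant: "vector_field B U X \<Longrightarrow> vector_field B U Y \<Longrightarrow> p \<in> U \<Longrightarrow>
      nabla (left_translate B mul iv h X) (left_translate B mul iv h Y) (mul h p) =
      pushforward B (mul h) p (nabla X Y p)"

text \<open>The Lie algebra is the tangent space at the identity; \<open>x\<close> in it is identified with the left
  invariant vector field \<open>left_invariant_field B mul one x\<close>.\<close>

definition left_invariant_field ::
  "('n::topological_space, 'b::real_inner) atlas \<Rightarrow> ('n \<Rightarrow> 'n \<Rightarrow> 'n) \<Rightarrow> 'n \<Rightarrow> 'n tvec \<Rightarrow> 'n \<Rightarrow> 'n tvec" where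
  "left_invariant_field B mul one x h = pushforward B (mul h) one x"

text \<open>For left invariant \<open>\<nabla>\<close> and left invariant \<open>X\<close>, \<open>Y\<close>, the field \<open>\<nabla>\<^sub>X Y\<close> is left invariant and
  thus identified with its value at the identity.\<close>

definition connection_function ::
  "('n::topological_space, 'b::real_inner) atlas \<Rightarrow> ('n \<Rightarrow> 'n \<Rightarrow> 'n) \<Rightarrow> 'n \<Rightarrow>
    (('n \<Rightarrow> 'n tvec) \<Rightarrow> ('n \<Rightarrow> 'n tvec) \<Rightarrow> 'n \<Rightarrow> 'n tvec) \<Rightarrow> 'n tvec \<Rightarrow> 'n tvec \<Rightarrow> 'n tvec" where
  "connection_function B mul one nabla x y =
    nabla (left_invariant_field B mul one x) (left_invariant_field B mul one y) one"

definition maurer_cartan ::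
  "('n::topological_space, 'b::real_inner) atlas \<Rightarrow> ('n \<Rightarrow> 'n \<Rightarrow> 'n) \<Rightarrow> ('n \<Rightarrow> 'n) \<Rightarrow>
    'n \<Rightarrow> 'n tvec \<Rightarrow> 'n tvec" where
  "maurer_cartan B mul iv h v = pushforward B (mul (iv h)) h v"

definition pullback_form ::
  "('n::topological_space, 'b::real_inner) atlas \<Rightarrow> ('m \<Rightarrow> 'n) \<Rightarrow> ('n \<Rightarrow> 'n tvec \<Rightarrow> 'k tvec) \<Rightarrow>
    'm \<Rightarrow> 'm tvec \<Rightarrow> 'k tvec" where
  "pullback_form B F \<omega> p v = \<omega> (F p) (pushforward B F p v)"

end

theory Submission
  imports Defs
begin

text \<open>For a vector field \<open>X\<close> on \<open>M\<close> put \<open>u = \<omega>\<^sub>G(F\<^sub>*X)\<close>, a function with values in the Lie algebra.  In a left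
  invariant frame \<open>E\<^sub>a\<close> of \<open>G\<close> this means \<open>F\<^sub>*X = \<Sum> u\<^sub>a (E\<^sub>a \<circ> F)\<close>, and the Leibniz rule shows that
  \<open>\<nabla>'\<^sub>X(F\<^sub>*X)\<close> is \<open>\<Sum> X(u\<^sub>a) (E\<^sub>a \<circ> F)\<close> plus the left translate of \<open>\<alpha>(u, u)\<close>, which is \<open>0\<close>.
  Hence \<open>\<beta>\<^sub>F(X, X)\<close> at \<open>p\<close> is the left translate by \<open>F p\<close> of \<open>X(u) - \<omega>\<^sub>G(F\<^sub>*(\<nabla>\<^sub>X X))\<close>.
  Summing over an orthonormal frame, \<open>\<tau>\<^sub>F\<close> is the left translate of \<open>- d\<^sup>*F\<^sup>*\<omega>\<^sub>G\<close>.\<close>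

section \<open>Calculus of smooth functions\<close>

text \<open>The induced connection is prescribed only on sections \<open>Y \<circ> F\<close>, and
  \<open>F_* X\<close> need not have this form. Left invariant fields remove the obstacle: they form
  a global frame of \<open>G\<close>, so \<open>F_* X\<close> becomes a combination of sections
  \<open>E_a \<circ> F\<close> with coefficients on \<open>M\<close>, and they extend every tangent
  vector of \<open>G\<close> to a field, as \<open>induced\<close> demands. The extension of
  \<open>F_*(X p)\<close> and the combination of the \<open>E_a\<close> with coefficients frozen at
  \<open>p\<close> are the same left invariant field, which is why \<alpha> is met on the diagonal.
  The Leibniz rule requires smooth coefficients. This is delicate because the Maurer-Cartan form at
  \<open>F q\<close> tests on the function \<open>f (mul (iv (F q)) k)\<close> of \<open>k\<close>,
  which itself moves with \<open>q\<close>: a field has to be applied to a function that depends on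
  the base point as a parameter. Smoothness of left invariant fields raises the same difficulty.
  Tension field and co-differential refer to the same chosen frame and are compared term by term.
  The choice has the required properties only if a local orthonormal frame exists, hence the
  Gram-Schmidt process.\<close>

definition fin_dim :: "'a::real_vector itself \<Rightarrow> bool" where
  "fin_dim _ \<longleftrightarrow> (\<exists>E::'a set. finite E \<and> span E = UNIV)"

definition onb :: "'a::real_inner set \<Rightarrow> bool" where
  "onb E \<longleftrightarrow> finite E \<and> span E = UNIV \<and> (\<forall>b\<in>E. \<forall>c\<in>E. b \<bullet> c = (if b = c then 1 else 0))"

lemma onb_finite: "onb E \<Longrightarrow> finite E"
  by (simp add: onb_def)

lemma onb_exists:
  assumes "fin_dim TYPE('a::real_inner)"
  obtains E :: "'a::real_inner set" where "onb E"
proof -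
  obtain E0 :: "'a set" where E0: "finite E0" "span E0 = UNIV"
    using assms by (auto simp: fin_dim_def)
  obtain C where C: "finite C" "span C = span E0" "pairwise orthogonal C"
    using basis_orthogonal[OF E0(1)] by blast
  \<comment> \<open>The orthogonal spanning set may contain 0, which cannot be normalised and
    contributes nothing to the span.\<close>
  define E where "E = sgn ` (C - {0})"
  have sc: "sgn c \<in> span (C - {0})" if "c \<in> C - {0}" for c
    unfolding sgn_div_norm using that by (intro span_scale span_base)
  have "span E = span (C - {0})"
  proof
    show "span E \<subseteq> span (C - {0})"
      unfolding E_def using sc by (intro span_minimal) auto
    have "c \<in> span E" if "c \<in> C - {0}" for c
    proof -
      have "c = norm c *\<^sub>R sgn c" using that by (simp add: sgn_div_norm)
      moreover have "sgn c \<in> span E" using that by (auto simp: E_def intro: span_base)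
      ultimately show ?thesis by (metis span_scale)
    qed
    then show "span (C - {0}) \<subseteq> span E" by (intro span_minimal) auto
  qed
  then have 1: "span E = UNIV" using C E0 by simp
  have 2: "b \<bullet> c = (if b = c then 1 else 0)" if "b \<in> E" "c \<in> E" for b c
  proof -
    obtain b' c' where bc: "b = sgn b'" "c = sgn c'" "b' \<in> C" "c' \<in> C" "b' \<noteq> 0" "c' \<noteq> 0"
      using \<open>b \<in> E\<close> \<open>c \<in> E\<close> by (auto simp: E_def)
    show ?thesis
    proof (cases "b = c")
      case True
      then have "b \<bullet> c = (norm b)\<^sup>2" by (simp add: dot_square_norm)
      also have "norm b = 1" using bc by (simp add: norm_sgn)
      finally show ?thesis using True by simp
    next
      case False
      then have "b' \<noteq> c'" using bc by auto
      then have "b' \<bullet> c' = 0" using C(3) bc by (auto simp: pairwise_def orthogonal_def)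
      then show ?thesis using bc False by (simp add: sgn_div_norm)
    qed
  qed
  have "onb E" using C 1 2 by (simp add: onb_def E_def)
  then show ?thesis by (rule that)
qed

lemma onb_expand:
  assumes "onb E"
  shows "v = (\<Sum>b\<in>E. (v \<bullet> b) *\<^sub>R b)"
proof -
  have fE: "finite E" and sE: "span E = UNIV"
    and o: "\<And>b c. b\<in>E \<Longrightarrow> c\<in>E \<Longrightarrow> b \<bullet> c = (if b = c then 1 else 0)"
    using assms by (auto simp: onb_def)
  obtain u where u: "v = (\<Sum>b\<in>E. u b *\<^sub>R b)"
    using sE span_finite[OF fE] by (metis (no_types, lifting) UNIV_I image_iff)
  have "v \<bullet> c = u c" if "c \<in> E" for c
  proof -
    have "v \<bullet> c = (\<Sum>b\<in>E. if b = c then u b else 0)"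
      unfolding u inner_sum_left using that by (intro sum.cong) (auto simp: o)
    then show ?thesis using that fE by simp
  qed
  then show ?thesis using u by simp
qed

lemma fin_dim_prod:
  assumes "fin_dim TYPE('a::real_vector)" "fin_dim TYPE('b::real_vector)"
  shows "fin_dim TYPE('a \<times> 'b)"
proof -
  obtain E :: "'a set" and E' :: "'b set" where
    E: "finite E" "span E = UNIV" "finite E'" "span E' = UNIV"
    using assms by (auto simp: fin_dim_def)
  let ?l = "\<lambda>a::'a. (a, 0::'b)" and ?r = "\<lambda>b::'b. (0::'a, b)"
  have l: "linear ?l" "linear ?r" by (auto intro!: linearI)
  have "x \<in> span (?l ` E \<union> ?r ` E')" for x
  proof -
    have "?l (fst x) \<in> span (?l ` E)" "?r (snd x) \<in> span (?r ` E')"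
      using E by (simp_all add: linear_span_image[OF l(1)] linear_span_image[OF l(2)])
    then have "?l (fst x) + ?r (snd x) \<in> span (?l ` E \<union> ?r ` E')"
      by (meson span_add span_mono sup_ge1 sup_ge2 subset_iff)
    then show ?thesis by simp
  qed
  then show ?thesis using E unfolding fin_dim_def
    by (intro exI[of _ "?l ` E \<union> ?r ` E'"]) auto
qed

lemma fin_dim_real: "fin_dim TYPE(real)"
  unfolding fin_dim_def by (intro exI[of _ "{1}"]) (auto simp: span_singleton)

section \<open>Closure properties of C^k functions\<close>

lemma Ck_on_subset: "Ck_on k S f \<Longrightarrow> T \<subseteq> S \<Longrightarrow> Ck_on k T f"
  by (induction k arbitrary: f) (auto intro: continuous_on_subset)

text \<open>The derivative at a point depends on the values nearby, so agreement on \<open>S\<close>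
  passes to derivatives because \<open>S\<close> is open. Below, this replaces an abstract
  derivative by an explicit formula.\<close>

lemma Ck_on_cong_imp:
  "Ck_on k S f \<Longrightarrow> open S \<Longrightarrow> (\<And>x. x \<in> S \<Longrightarrow> f x = g x) \<Longrightarrow> Ck_on k S g"
proof (induction k arbitrary: f g)
  case 0
  then show ?case by (simp cong: continuous_on_cong)
next
  case (Suc k)
  have *: "(g has_derivative frechet_derivative f (at x)) (at x)" if "x \<in> S" for x
  proof -
    have "(f has_derivative frechet_derivative f (at x)) (at x)"
      using Suc.prems(1) that frechet_derivative_works by auto
    then show ?thesis
      using has_derivative_transform_within_open[of f _ x UNIV S g] Suc.prems that by auto
  qed
  have **: "frechet_derivative g (at x) = frechet_derivative f (at x)" if "x \<in> S" for x
    using frechet_derivative_at[OF *[OF that]] by simp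
  have "Ck_on k S (\<lambda>x. frechet_derivative g (at x) v)" for v
    by (rule Suc.IH[where f="\<lambda>x. frechet_derivative f (at x) v"]) (use Suc.prems ** in auto)
  then show ?case using * unfolding Ck_on.simps differentiable_def by blast
qed

lemma Ck_on_local:
  "(\<And>x. x \<in> S \<Longrightarrow> \<exists>T. open T \<and> x \<in> T \<and> Ck_on k T f) \<Longrightarrow> Ck_on k S f"
proof (induction k arbitrary: f)
  case 0
  have "isCont f x" if "x \<in> S" for x
    using 0[OF that] by (auto simp: continuous_on_eq_continuous_at)
  then show ?case by (simp add: continuous_at_imp_continuous_on)
next
  case (Suc k)
  then show ?case
    by simp (meson Suc.IH)
qed

text \<open>Level \<open>Suc k\<close> does not mention level \<open>k\<close> of the function
  itself. The inclusion is needed in product and chain rules, where undifferentiated factors survive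
  next to the derivatives.\<close>

lemma Ck_on_Suc_D: "Ck_on (Suc k) S f \<Longrightarrow> Ck_on k S f"
proof (induction k arbitrary: f)
  case 0
  then show ?case
    by (meson Ck_on.simps differentiable_at_withinI differentiable_imp_continuous_on differentiable_on_def)
next
  case (Suc k)
  then show ?case by (metis Ck_on.simps(2))
qed

lemma Ck_on_const: "Ck_on k S (\<lambda>x. c)"
  by (induction k arbitrary: c) auto

lemma Ck_on_bounded_linear:
  assumes "bounded_linear L" shows "Ck_on k S L"
proof -
  have d: "(L has_derivative L) (at x)" for x
    using assms by (rule bounded_linear_imp_has_derivative)
  show ?thesis
  proof (cases k)
    case 0 then show ?thesis using assms by (simp add: linear_continuous_on)
  next
    case (Suc k')
    have "frechet_derivative L (at x) = L" for x
      using frechet_derivative_at[OF d] by simp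
    then show ?thesis using d Suc by (auto simp: Ck_on_const intro: differentiableI)
  qed
qed

lemma Ck_on_add:
  "open S \<Longrightarrow> Ck_on k S f \<Longrightarrow> Ck_on k S g \<Longrightarrow> Ck_on k S (\<lambda>x. f x + g x)"
proof (induction k arbitrary: f g)
  case 0
  then show ?case by (auto intro: continuous_on_add)
next
  case (Suc k)
  have "frechet_derivative (\<lambda>x. f x + g x) (at x) = (\<lambda>v. frechet_derivative f (at x) v + frechet_derivative g (at x) v)"
    if "x \<in> S" for x
    using Suc.prems that
    by (intro frechet_derivative_at[symmetric] has_derivative_add) (auto simp: frechet_derivative_works)
  then have 1: "frechet_derivative (\<lambda>x. f x + g x) (at x) v = frechet_derivative f (at x) v + frechet_derivative g (at x) v"
    if "x \<in> S" for x v
    using that by simp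
  have "Ck_on k S (\<lambda>x. frechet_derivative (\<lambda>x. f x + g x) (at x) v)" for v
    by (rule Ck_on_cong_imp[OF Suc.IH[where f="\<lambda>x. frechet_derivative f (at x) v" and g="\<lambda>x. frechet_derivative g (at x) v"]])
      (use Suc.prems 1 in auto)
  then show ?case using Suc.prems by auto
qed

lemma Ck_on_sum:
  "open S \<Longrightarrow> (\<And>i. i \<in> I \<Longrightarrow> Ck_on k S (f i)) \<Longrightarrow> Ck_on k S (\<lambda>x. \<Sum>i\<in>I. f i x)"
  by (induction I rule: infinite_finite_induct) (auto intro: Ck_on_const Ck_on_add)

text \<open>By the product rule, the derivative in a fixed direction is a sum of two terms
  \<open>h _ _\<close> with arguments of class C^k, so the induction hypothesis applies to both. One
  proof covers scaling, inner products and multiplication.\<close>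

lemma Ck_on_bilinear:
  assumes "bounded_bilinear h"
  shows "open S \<Longrightarrow> Ck_on k S f \<Longrightarrow> Ck_on k S g \<Longrightarrow> Ck_on k S (\<lambda>x. h (f x) (g x))"
proof (induction k arbitrary: f g)
  case 0
  then show ?case using bounded_bilinear.continuous_on[OF assms] by auto
next
  case (Suc k)
  have d: "((\<lambda>x. h (f x) (g x)) has_derivative
     (\<lambda>v. h (f x) (frechet_derivative g (at x) v) + h (frechet_derivative f (at x) v) (g x))) (at x)"
    if "x \<in> S" for x
    using Suc.prems that
    by (intro bounded_bilinear.FDERIV[OF assms]) (auto simp: frechet_derivative_works)
  have fg: "Ck_on k S f" "Ck_on k S g" using Suc.prems Ck_on_Suc_D by blast+
  have 1: "Ck_on k S (\<lambda>x. h (f x) (frechet_derivative g (at x) v) + h (frechet_derivative f (at x) v) (g x))" for v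
    using Suc.prems fg
    by (intro Ck_on_add Suc.IH[where g="\<lambda>x. frechet_derivative g (at x) v"]
        Suc.IH[where f="\<lambda>x. frechet_derivative f (at x) v"]) auto
  have "Ck_on k S (\<lambda>x. frechet_derivative (\<lambda>x. h (f x) (g x)) (at x) v)" for v
    by (rule Ck_on_cong_imp[OF 1[of v] \<open>open S\<close>]) (simp flip: frechet_derivative_at[OF d])
  then show ?case using d unfolding Ck_on.simps differentiable_def by blast
qed

lemmas Ck_on_scaleR = Ck_on_bilinear[OF bounded_bilinear_scaleR]
lemmas Ck_on_inner = Ck_on_bilinear[OF bounded_bilinear_inner]

text \<open>\<open>Ck_on\<close> controls derivatives in fixed directions only. Linearity reduces a
  direction that varies with the point to the finitely many fixed directions in
  \<open>E\<close>.\<close>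

lemma frechet_derivative_onb:
  assumes "onb E" "g differentiable (at y)"
  shows "frechet_derivative g (at y) w = (\<Sum>b\<in>E. (w \<bullet> b) *\<^sub>R frechet_derivative g (at y) b)"
proof -
  have l: "linear (frechet_derivative g (at y))"
    using assms(2) by (simp add: linear_frechet_derivative)
  have "frechet_derivative g (at y) w = frechet_derivative g (at y) (\<Sum>b\<in>E. (w \<bullet> b) *\<^sub>R b)"
    using onb_expand[OF assms(1), of w] by simp
  also have "\<dots> = (\<Sum>b\<in>E. (w \<bullet> b) *\<^sub>R frechet_derivative g (at y) b)"
    using l by (simp add: linear_sum linear_scale)
  finally show ?thesis .
qed

text \<open>The chain rule produces the derivative of \<open>g\<close> in the moving direction
  \<open>f'(x) v\<close>. Expanded in \<open>E\<close>, it is a sum of products of components of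
  \<open>f'(x) v\<close> with composites of \<open>f\<close> and directional derivatives of
  \<open>g\<close>; these composites are covered by the induction hypothesis, in which
  \<open>g\<close> varies and \<open>f\<close> stays fixed.\<close>

lemma Ck_on_compose:
  fixes f :: "'a::real_normed_vector \<Rightarrow> 'b::real_inner" and g :: "'b \<Rightarrow> 'c::real_normed_vector"
  assumes E: "onb (E::'b set)" and S: "open S"
  shows "Ck_on k S f \<Longrightarrow> Ck_on k T g \<Longrightarrow> f ` S \<subseteq> T \<Longrightarrow> Ck_on k S (\<lambda>x. g (f x))"
proof (induction k arbitrary: g)
  case 0
  then show ?case by (auto intro: continuous_on_compose2)
next
  case (Suc k)
  have d: "((\<lambda>x. g (f x)) has_derivative
     (\<lambda>v. frechet_derivative g (at (f x)) (frechet_derivative f (at x) v))) (at x)" if "x \<in> S" for x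
  proof -
    have "(g \<circ> f has_derivative frechet_derivative g (at (f x)) \<circ> frechet_derivative f (at x)) (at x)"
      using Suc.prems that by (intro diff_chain_at) (auto simp flip: frechet_derivative_works)
    then show ?thesis by (simp add: o_def)
  qed
  have fk: "Ck_on k S f" using Suc.prems(1) by (rule Ck_on_Suc_D)
  have 1: "Ck_on k S (\<lambda>x. \<Sum>b\<in>E. (frechet_derivative f (at x) v \<bullet> b) *\<^sub>R frechet_derivative g (at (f x)) b)" for v
    using Suc.prems fk S
    by (intro Ck_on_sum Ck_on_scaleR Ck_on_inner Ck_on_const Suc.IH[where g="\<lambda>y. frechet_derivative g (at y) b" for b]) auto
  have 2: "frechet_derivative (\<lambda>x. g (f x)) (at x) v =
      (\<Sum>b\<in>E. (frechet_derivative f (at x) v \<bullet> b) *\<^sub>R frechet_derivative g (at (f x)) b)" if "x \<in> S" for x v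
  proof -
    have "g differentiable (at (f x))" using Suc.prems that by auto
    then show ?thesis
      using frechet_derivative_onb[OF E] by (simp flip: frechet_derivative_at[OF d[OF that]])
  qed
  have "Ck_on k S (\<lambda>x. frechet_derivative (\<lambda>x. g (f x)) (at x) v)" for v
    by (rule Ck_on_cong_imp[OF 1[of v] S]) (simp add: 2)
  then show ?case using d unfolding Ck_on.simps differentiable_def by blast
qed

section \<open>Smooth functions: all orders at once\<close>

lemma smooth_on_subset: "smooth_on S f \<Longrightarrow> T \<subseteq> S \<Longrightarrow> smooth_on T f"
  by (auto simp: smooth_on_def intro: Ck_on_subset)

lemma smooth_on_cong_imp:
  "smooth_on S f \<Longrightarrow> open S \<Longrightarrow> (\<And>x. x \<in> S \<Longrightarrow> f x = g x) \<Longrightarrow> smooth_on S g"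
  by (auto simp: smooth_on_def intro: Ck_on_cong_imp)

lemma smooth_on_local:
  "(\<And>x. x \<in> S \<Longrightarrow> \<exists>T. open T \<and> x \<in> T \<and> smooth_on T f) \<Longrightarrow> smooth_on S f"
  unfolding smooth_on_def by (meson Ck_on_local)

lemma smooth_on_const: "smooth_on S (\<lambda>x. c)"
  by (simp add: smooth_on_def Ck_on_const)

lemma smooth_on_bounded_linear: "bounded_linear L \<Longrightarrow> smooth_on S L"
  by (simp add: smooth_on_def Ck_on_bounded_linear)

lemma smooth_on_add:
  "open S \<Longrightarrow> smooth_on S f \<Longrightarrow> smooth_on S g \<Longrightarrow> smooth_on S (\<lambda>x. f x + g x)"
  by (simp add: smooth_on_def Ck_on_add)

lemma smooth_on_sum:
  "open S \<Longrightarrow> (\<And>i. i \<in> I \<Longrightarrow> smooth_on S (f i)) \<Longrightarrow> smooth_on S (\<lambda>x. \<Sum>i\<in>I. f i x)"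
  by (simp add: smooth_on_def Ck_on_sum)

lemma smooth_on_bilinear:
  "bounded_bilinear h \<Longrightarrow> open S \<Longrightarrow> smooth_on S f \<Longrightarrow> smooth_on S g \<Longrightarrow> smooth_on S (\<lambda>x. h (f x) (g x))"
  by (simp add: smooth_on_def Ck_on_bilinear)

lemmas smooth_on_scaleR = smooth_on_bilinear[OF bounded_bilinear_scaleR]
lemmas smooth_on_mult = smooth_on_bilinear[OF bounded_bilinear_mult]
lemmas smooth_on_inner = smooth_on_bilinear[OF bounded_bilinear_inner]

lemma smooth_on_compose:
  fixes f :: "'a::real_normed_vector \<Rightarrow> 'b::real_inner" and g :: "'b \<Rightarrow> 'c::real_normed_vector"
  assumes "fin_dim TYPE('b)" "open S" "smooth_on S f" "smooth_on T g" "f ` S \<subseteq> T"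
  shows "smooth_on S (\<lambda>x. g (f x))"
proof -
  obtain E :: "'b set" where E: "onb E" using onb_exists[OF assms(1)] .
  show ?thesis using assms unfolding smooth_on_def by (blast intro: Ck_on_compose[OF E])
qed

lemma smooth_on_continuous_on: "smooth_on S f \<Longrightarrow> continuous_on S f"
  unfolding smooth_on_def by (drule spec[of _ 0]) simp

lemma smooth_on_differentiable: "smooth_on S f \<Longrightarrow> x \<in> S \<Longrightarrow> f differentiable (at x)"
  unfolding smooth_on_def by (drule spec[of _ "Suc 0"]) simp

lemma smooth_on_frechet:
  assumes "smooth_on S f" shows "smooth_on S (\<lambda>x. frechet_derivative f (at x) v)"
  unfolding smooth_on_def
proof
  fix k
  show "Ck_on k S (\<lambda>x. frechet_derivative f (at x) v)"
    using assms[unfolded smooth_on_def, THEN spec, of "Suc k"] by simp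
qed

text \<open>The pair is \<open>(f x, 0) + (0, g x)\<close>, a sum of compositions with bounded
  linear embeddings.\<close>

lemma smooth_on_Pair:
  fixes f :: "'a::real_normed_vector \<Rightarrow> 'b::real_inner" and g :: "'a \<Rightarrow> 'c::real_inner"
  assumes fd: "fin_dim TYPE('b)" "fin_dim TYPE('c)"
    and S: "open S" and f: "smooth_on S f" and g: "smooth_on S g"
  shows "smooth_on S (\<lambda>x. (f x, g x))"
proof -
  have "bounded_linear (\<lambda>a::'b. (a, 0::'c))" "bounded_linear (\<lambda>b::'c. (0::'b, b))"
    by (auto intro!: bounded_linear_Pair bounded_linear_ident bounded_linear_zero)
  then have "smooth_on S (\<lambda>x. (f x, 0::'c) + (0::'b, g x))"
    by (intro smooth_on_add S smooth_on_compose[OF fd(1) S f] smooth_on_compose[OF fd(2) S g] smooth_on_bounded_linear) auto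
  then show ?thesis by simp
qed

text \<open>Both the point \<open>z x\<close> and the direction \<open>w x\<close> move; the
  expansion in an orthonormal basis separates the two dependences.\<close>

lemma smooth_on_frechet_compose:
  fixes g :: "'b::real_inner \<Rightarrow> 'c::real_normed_vector" and z w :: "'a::real_normed_vector \<Rightarrow> 'b"
  assumes fd: "fin_dim TYPE('b)" and S: "open S" and z: "smooth_on S z" and w: "smooth_on S w"
    and g: "smooth_on T g" and zT: "z ` S \<subseteq> T"
  shows "smooth_on S (\<lambda>x. frechet_derivative g (at (z x)) (w x))"
proof -
  obtain E :: "'b set" where E: "onb E" using onb_exists[OF fd] .
  have "smooth_on S (\<lambda>x. \<Sum>b\<in>E. (w x \<bullet> b) *\<^sub>R frechet_derivative g (at (z x)) b)"
    using S smooth_on_compose[OF fd S z smooth_on_frechet[OF g] zT]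
    by (intro smooth_on_sum smooth_on_scaleR smooth_on_inner smooth_on_const w) auto
  then show ?thesis
    by (rule smooth_on_cong_imp)
      (use S zT g in \<open>auto intro!: frechet_derivative_onb[OF E, symmetric] smooth_on_differentiable\<close>)
qed

text \<open>Factor and exponent are arbitrary so that the family is closed under differentiation.
  The exponent -1/2 is used to normalise a vector field.\<close>

lemma Ck_on_powr: "Ck_on k {0<..} (\<lambda>x::real. c * x powr a)"
proof (induction k arbitrary: a c)
  case 0
  then show ?case by (auto intro!: continuous_intros)
next
  case (Suc k)
  have d: "((\<lambda>x::real. c * x powr a) has_derivative (\<lambda>v. (c * a * v) * x powr (a - 1))) (at x)"
    if "x > 0" for x
  proof -
    have "((\<lambda>x::real. c * x powr a) has_real_derivative c * (a * x powr (a - 1))) (at x)"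
      using that by (intro DERIV_cmult has_real_derivative_powr)
    then show ?thesis
      by (rule has_derivative_eq_rhs[OF has_field_derivative_imp_has_derivative]) (simp add: fun_eq_iff)
  qed
  have "Ck_on k {0<..} (\<lambda>x. frechet_derivative (\<lambda>x. c * x powr a) (at x) v)" for v
    by (rule Ck_on_cong_imp[OF Suc[of "c * a * v" "a - 1"]])
      (simp_all flip: frechet_derivative_at[OF d])
  then show ?case using d unfolding Ck_on.simps differentiable_def by blast
qed

lemma smooth_on_powr: "smooth_on {0<..} (\<lambda>x::real. x powr a)"
  using Ck_on_powr[of _ 1 a] by (simp add: smooth_on_def)

section \<open>Smooth maps between manifolds\<close>

lemma smooth_manifold_fin_dim:
  "smooth_manifold (A :: ('m::{t2_space,second_countable_topology}, 'a::real_inner) atlas) \<Longrightarrow> fin_dim TYPE('a)"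
  unfolding fin_dim_def by (rule smooth_manifold.finite_dimensional)

lemma chart_at:
  assumes "smooth_manifold A"
  obtains U \<phi> where "(U, \<phi>) \<in> A" "p \<in> U"
proof -
  have "p \<in> (\<Union>(U, \<phi>)\<in>A. U)" by (simp add: smooth_manifold.covers[OF assms])
  then show ?thesis using that by auto
qed

lemma chart_open: "smooth_manifold A \<Longrightarrow> (U, \<phi>) \<in> A \<Longrightarrow> open U"
  by (simp add: smooth_manifold.chart)

lemma chart_inv: "smooth_manifold A \<Longrightarrow> (U, \<phi>) \<in> A \<Longrightarrow> p \<in> U \<Longrightarrow> inv_into U \<phi> (\<phi> p) = p"
  by (simp add: smooth_manifold.chart)

lemma chart_continuous: "smooth_manifold A \<Longrightarrow> (U, \<phi>) \<in> A \<Longrightarrow> continuous_on U \<phi>"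
  by (simp add: smooth_manifold.chart)

lemma chart_open_image:
  assumes M: "smooth_manifold A" "(U, \<phi>) \<in> A" and N: "open N" "N \<subseteq> U"
  shows "open (\<phi> ` N)"
proof -
  have "\<phi> ` N = inv_into U \<phi> -` N \<inter> \<phi> ` U"
    using N(2) chart_inv[OF M] by force
  moreover have "open \<dots>"
    using smooth_manifold.chart[OF M] N(1) continuous_on_open_vimage by blast
  ultimately show ?thesis by simp
qed

lemma open_Int_vimage: "open W \<Longrightarrow> continuous_on W F \<Longrightarrow> open V \<Longrightarrow> open (W \<inter> F -` V)"
  by (metis continuous_on_open_vimage inf_commute)

lemma smooth_map_on_open: "smooth_map_on A B W F \<Longrightarrow> open W"
  and smooth_map_on_continuous: "smooth_map_on A B W F \<Longrightarrow> continuous_on W F"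
  by (simp_all add: smooth_map_on_def)

lemma smooth_map_onD:
  "smooth_map_on A B W F \<Longrightarrow> (U, \<phi>) \<in> A \<Longrightarrow> (V, \<psi>) \<in> B \<Longrightarrow> N \<subseteq> W \<inter> U \<inter> F -` V \<Longrightarrow>
    smooth_on (\<phi> ` N) (\<psi> \<circ> F \<circ> inv_into U \<phi>)"
  unfolding smooth_map_on_def by (blast intro: smooth_on_subset[OF _ image_mono])

text \<open>The definition quantifies over all pairs of charts, but one pair around each point is
  enough: any other local representative arises by composing with transition maps on both
  sides.\<close>

lemma smooth_map_onI:
  fixes A :: "('m::{t2_space,second_countable_topology}, 'a::real_inner) atlas"
    and B :: "('n::{t2_space,second_countable_topology}, 'b::real_inner) atlas"
  assumes A: "smooth_manifold A" and B: "smooth_manifold B"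
    and W: "open W" and F: "continuous_on W F"
    and loc: "\<And>p. p \<in> W \<Longrightarrow> \<exists>U \<phi> V \<psi> N. (U, \<phi>) \<in> A \<and> (V, \<psi>) \<in> B \<and> open N \<and> p \<in> N \<and>
      N \<subseteq> W \<inter> U \<inter> F -` V \<and> smooth_on (\<phi> ` N) (\<psi> \<circ> F \<circ> inv_into U \<phi>)"
  shows "smooth_map_on A B W F"
proof -
  have "smooth_on (\<phi>' ` (W \<inter> U' \<inter> F -` V')) (\<psi>' \<circ> F \<circ> inv_into U' \<phi>')"
    if c: "(U', \<phi>') \<in> A" "(V', \<psi>') \<in> B" for U' \<phi>' V' \<psi>'
  proof (rule smooth_on_local)
    fix x assume "x \<in> \<phi>' ` (W \<inter> U' \<inter> F -` V')"
    then obtain p where p: "p \<in> W" "p \<in> U'" "F p \<in> V'" "x = \<phi>' p" by auto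
    obtain U \<phi> V \<psi> N where l: "(U, \<phi>) \<in> A" "(V, \<psi>) \<in> B" "open N" "p \<in> N"
      "N \<subseteq> W \<inter> U \<inter> F -` V" "smooth_on (\<phi> ` N) (\<psi> \<circ> F \<circ> inv_into U \<phi>)"
      using loc[OF p(1)] by blast
    \<comment> \<open>Small enough for all four charts: on \<open>N'\<close> both the old and the
      new representative are defined, and transition maps connect them.\<close>
    define N' where "N' = (W \<inter> F -` V') \<inter> N \<inter> U'"
    have "open N'" unfolding N'_def using W F l c A B
      by (intro open_Int open_Int_vimage) (auto intro: chart_open)
    then have o: "open (\<phi>' ` N')" using chart_open_image[OF A c(1)] by (auto simp: N'_def)
    have s1: "smooth_on (\<phi>' ` N') (\<phi> \<circ> inv_into U' \<phi>')"
      by (rule smooth_on_subset[OF smooth_manifold.compatible[OF A c(1) l(1)]]) (use l in \<open>auto simp: N'_def\<close>)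
    have s2: "smooth_on (\<psi> ` (V \<inter> V')) (\<psi>' \<circ> inv_into V \<psi>)"
      by (rule smooth_manifold.compatible[OF B l(2) c(2)])
    have i1: "(\<phi> \<circ> inv_into U' \<phi>') ` \<phi>' ` N' \<subseteq> \<phi> ` N"
      using chart_inv[OF A c(1)] by (auto simp: N'_def)
    have s3: "smooth_on (\<phi>' ` N') (\<lambda>y. (\<psi> \<circ> F \<circ> inv_into U \<phi>) ((\<phi> \<circ> inv_into U' \<phi>') y))"
      by (rule smooth_on_compose[OF smooth_manifold_fin_dim[OF A] o s1 l(6) i1])
    have i2: "(\<lambda>y. (\<psi> \<circ> F \<circ> inv_into U \<phi>) ((\<phi> \<circ> inv_into U' \<phi>') y)) ` \<phi>' ` N' \<subseteq> \<psi> ` (V \<inter> V')"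
    proof
      fix z assume "z \<in> (\<lambda>y. (\<psi> \<circ> F \<circ> inv_into U \<phi>) ((\<phi> \<circ> inv_into U' \<phi>') y)) ` \<phi>' ` N'"
      then obtain q where q: "q \<in> N'" "z = \<psi> (F (inv_into U \<phi> (\<phi> (inv_into U' \<phi>' (\<phi>' q)))))" by auto
      then have "z = \<psi> (F q)" using l(5) chart_inv[OF A c(1), of q] chart_inv[OF A l(1), of q]
        by (auto simp: N'_def)
      then show "z \<in> \<psi> ` (V \<inter> V')" using q l(5) by (auto simp: N'_def)
    qed
    have "smooth_on (\<phi>' ` N') (\<lambda>y. (\<psi>' \<circ> inv_into V \<psi>) ((\<psi> \<circ> F \<circ> inv_into U \<phi>) ((\<phi> \<circ> inv_into U' \<phi>') y)))"
      by (rule smooth_on_compose[OF smooth_manifold_fin_dim[OF B] o s3 s2 i2])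
    then have "smooth_on (\<phi>' ` N') (\<psi>' \<circ> F \<circ> inv_into U' \<phi>')"
    proof (rule smooth_on_cong_imp[OF _ o])
      fix x assume "x \<in> \<phi>' ` N'"
      then obtain q where q: "q \<in> N'" "x = \<phi>' q" by auto
      then show "(\<psi>' \<circ> inv_into V \<psi>) ((\<psi> \<circ> F \<circ> inv_into U \<phi>) ((\<phi> \<circ> inv_into U' \<phi>') x)) =
          (\<psi>' \<circ> F \<circ> inv_into U' \<phi>') x"
        using l(5) chart_inv[OF A c(1), of q] chart_inv[OF A l(1), of q] chart_inv[OF B l(2), of "F q"]
        by (simp add: N'_def subset_iff)
    qed
    moreover have "x \<in> \<phi>' ` N'" using p l(4) by (auto simp: N'_def)
    ultimately show "\<exists>T. open T \<and> x \<in> T \<and> smooth_on T (\<psi>' \<circ> F \<circ> inv_into U' \<phi>')"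
      using o by blast
  qed
  then show ?thesis using W F by (auto simp: smooth_map_on_def)
qed

lemma smooth_map_on_subset:
  "smooth_map_on A B W F \<Longrightarrow> open W' \<Longrightarrow> W' \<subseteq> W \<Longrightarrow> smooth_map_on A B W' F"
  unfolding smooth_map_on_def
  by (blast intro: continuous_on_subset smooth_on_subset[OF _ image_mono])

lemma smooth_map_on_cong:
  assumes A: "smooth_manifold A" and B: "smooth_manifold B"
    and F: "smooth_map_on A B W F" and eq: "\<And>p. p \<in> W \<Longrightarrow> F p = G p"
  shows "smooth_map_on A B W G"
proof -
  have 0: "open W" "continuous_on W F" "continuous_on W G"
    using F eq by (auto simp: smooth_map_on_def cong: continuous_on_cong)
  have "smooth_on (\<phi> ` (W \<inter> U \<inter> G -` V)) (\<psi> \<circ> G \<circ> inv_into U \<phi>)"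
    if c: "(U, \<phi>) \<in> A" "(V, \<psi>) \<in> B" for U \<phi> V \<psi>
  proof (rule smooth_on_cong_imp)
    have o: "open (W \<inter> G -` V \<inter> U)"
      by (intro open_Int open_Int_vimage 0 chart_open[OF A c(1)] chart_open[OF B c(2)])
    show "open (\<phi> ` (W \<inter> U \<inter> G -` V))"
      by (rule chart_open_image[OF A c(1)]) (use o in \<open>auto simp: Int_ac\<close>)
    show "smooth_on (\<phi> ` (W \<inter> U \<inter> G -` V)) (\<psi> \<circ> F \<circ> inv_into U \<phi>)"
      by (rule smooth_map_onD[OF F c]) (auto simp: eq)
  qed (use eq chart_inv[OF A c(1)] in auto)
  then show ?thesis using 0 by (auto simp: smooth_map_on_def)
qed

text \<open>A chart of the middle manifold around \<open>F p\<close> is inserted. Near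
  \<open>p\<close> the representative of the composite is then the composite of the
  representatives.\<close>

lemma smooth_map_on_compose:
  fixes A :: "('m::{t2_space,second_countable_topology}, 'a::real_inner) atlas"
    and B :: "('n::{t2_space,second_countable_topology}, 'b::real_inner) atlas"
    and C :: "('k::{t2_space,second_countable_topology}, 'c::real_inner) atlas"
  assumes A: "smooth_manifold A" and B: "smooth_manifold B" and C: "smooth_manifold C"
    and F: "smooth_map_on A B W F" and G: "smooth_map_on B C W' G"
  shows "smooth_map_on A C (W \<inter> F -` W') (\<lambda>p. G (F p))"
proof (rule smooth_map_onI[OF A C])
  have oW: "open W" "open W'" and cF: "continuous_on W F" and cG: "continuous_on W' G"
    using F G by (auto simp: smooth_map_on_def)
  show o: "open (W \<inter> F -` W')" by (intro open_Int_vimage oW cF)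
  show cGF: "continuous_on (W \<inter> F -` W') (\<lambda>p. G (F p))"
    by (rule continuous_on_compose2[OF cG continuous_on_subset[OF cF]]) auto
  fix p assume p: "p \<in> W \<inter> F -` W'"
  obtain U \<phi> where U: "(U, \<phi>) \<in> A" "p \<in> U" using chart_at[OF A] .
  obtain V \<psi> where V: "(V, \<psi>) \<in> B" "F p \<in> V" using chart_at[OF B] .
  obtain X \<xi> where X: "(X, \<xi>) \<in> C" "G (F p) \<in> X" using chart_at[OF C] .
  define N where "N = (W \<inter> F -` W') \<inter> (\<lambda>p. G (F p)) -` X \<inter> (W \<inter> F -` V) \<inter> U"
  have oN: "open N" unfolding N_def
    by (intro open_Int open_Int_vimage oW cF o cGF chart_open[OF A U(1)] chart_open[OF B V(1)] chart_open[OF C X(1)])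
  have oi: "open (\<phi> ` N)" by (rule chart_open_image[OF A U(1) oN]) (auto simp: N_def)
  have s1: "smooth_on (\<phi> ` N) (\<psi> \<circ> F \<circ> inv_into U \<phi>)"
    by (rule smooth_map_onD[OF F U(1) V(1)]) (auto simp: N_def)
  have s2: "smooth_on (\<psi> ` (W' \<inter> V \<inter> G -` X)) (\<xi> \<circ> G \<circ> inv_into V \<psi>)"
    by (rule smooth_map_onD[OF G V(1) X(1)]) auto
  have i: "(\<psi> \<circ> F \<circ> inv_into U \<phi>) ` \<phi> ` N \<subseteq> \<psi> ` (W' \<inter> V \<inter> G -` X)"
    using chart_inv[OF A U(1)] by (auto simp: N_def)
  have "smooth_on (\<phi> ` N) (\<lambda>x. (\<xi> \<circ> G \<circ> inv_into V \<psi>) ((\<psi> \<circ> F \<circ> inv_into U \<phi>) x))"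
    by (rule smooth_on_compose[OF smooth_manifold_fin_dim[OF B] oi s1 s2 i])
  then have "smooth_on (\<phi> ` N) (\<xi> \<circ> (\<lambda>p. G (F p)) \<circ> inv_into U \<phi>)"
    by (rule smooth_on_cong_imp[OF _ oi])
      (use chart_inv[OF A U(1)] chart_inv[OF B V(1)] in \<open>auto simp: N_def\<close>)
  then show "\<exists>U \<phi> V \<psi> N. (U, \<phi>) \<in> A \<and> (V, \<psi>) \<in> C \<and> open N \<and> p \<in> N \<and>
      N \<subseteq> (W \<inter> F -` W') \<inter> U \<inter> (\<lambda>p. G (F p)) -` V \<and>
      smooth_on (\<phi> ` N) (\<psi> \<circ> (\<lambda>p. G (F p)) \<circ> inv_into U \<phi>)"
    using U X p V oN by (intro exI[of _ U] exI[of _ \<phi>] exI[of _ X] exI[of _ \<xi>] exI[of _ N]) (auto simp: N_def)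
qed

lemma smooth_map_on_id:
  assumes A: "smooth_manifold A" and "open W"
  shows "smooth_map_on A A W (\<lambda>p. p)"
proof (rule smooth_map_onI[OF A A \<open>open W\<close>])
  fix p assume "p \<in> W"
  obtain U \<phi> where U: "(U, \<phi>) \<in> A" "p \<in> U" using chart_at[OF A] .
  have oi: "open (\<phi> ` (W \<inter> U))"
    by (rule chart_open_image[OF A U(1)]) (use chart_open[OF A U(1)] \<open>open W\<close> in auto)
  have "smooth_on (\<phi> ` (W \<inter> U)) (\<phi> \<circ> (\<lambda>p. p) \<circ> inv_into U \<phi>)"
    by (rule smooth_on_cong_imp[OF smooth_on_bounded_linear[OF bounded_linear_ident] oi])
      (use chart_inv[OF A U(1)] in auto)
  then show "\<exists>U \<phi> V \<psi> N. (U, \<phi>) \<in> A \<and> (V, \<psi>) \<in> A \<and> open N \<and> p \<in> N \<and>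
      N \<subseteq> W \<inter> U \<inter> (\<lambda>p. p) -` V \<and> smooth_on (\<phi> ` N) (\<psi> \<circ> (\<lambda>p. p) \<circ> inv_into U \<phi>)"
    using U \<open>p \<in> W\<close> chart_open[OF A U(1)] \<open>open W\<close>
    by (intro exI[of _ U] exI[of _ \<phi>] exI[of _ "W \<inter> U"]) auto
qed auto

lemma smooth_map_on_const:
  assumes A: "smooth_manifold A" and B: "smooth_manifold B" and "open W"
  shows "smooth_map_on A B W (\<lambda>p. q)"
  using \<open>open W\<close> by (auto simp: smooth_map_on_def comp_def smooth_on_const)

section \<open>Smooth real-valued functions\<close>

lemma std_atlas_manifold: "smooth_manifold (std_atlas :: (real, real) atlas)"
proof
  show "\<exists>E::real set. finite E \<and> span E = UNIV" using fin_dim_real by (simp add: fin_dim_def)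
qed (auto simp: std_atlas_def inv_into_def smooth_on_bounded_linear bounded_linear_ident comp_def)

text \<open>The target has the identity as its only chart, so no preimage of a chart domain has to
  be known open beforehand, and continuity follows from smoothness in coordinates.\<close>

lemma smooth_funI:
  fixes A :: "('m::{t2_space,second_countable_topology}, 'a::real_inner) atlas"
  assumes A: "smooth_manifold A" and W: "open W"
    and loc: "\<And>p. p \<in> W \<Longrightarrow> \<exists>U \<phi> N. (U, \<phi>) \<in> A \<and> open N \<and> p \<in> N \<and> N \<subseteq> W \<inter> U \<and>
      smooth_on (\<phi> ` N) (f \<circ> inv_into U \<phi>)"
  shows "smooth_fun A W f"
proof (rule smooth_map_onI[OF A std_atlas_manifold W])
  have "isCont f p" if "p \<in> W" for p
  proof -
    obtain U \<phi> N where U: "(U, \<phi>) \<in> A" "open N" "p \<in> N" "N \<subseteq> W \<inter> U"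
      and s: "smooth_on (\<phi> ` N) (f \<circ> inv_into U \<phi>)" using loc[OF \<open>p \<in> W\<close>] by blast
    have "continuous_on N ((f \<circ> inv_into U \<phi>) \<circ> \<phi>)"
      using U by (intro continuous_on_compose[OF continuous_on_subset[OF chart_continuous[OF A U(1)]]
        smooth_on_continuous_on[OF s]]) auto
    then have "continuous_on N f"
      by (rule continuous_on_eq) (use chart_inv[OF A U(1)] U in auto)
    then show ?thesis
      using that U by (simp add: continuous_on_eq_continuous_at)
  qed
  then show "continuous_on W f" by (simp add: continuous_at_imp_continuous_on)
  fix p assume "p \<in> W"
  then show "\<exists>U \<phi> V \<psi> N. (U, \<phi>) \<in> A \<and> (V, \<psi>) \<in> std_atlas \<and> open N \<and> p \<in> N \<and>
      N \<subseteq> W \<inter> U \<inter> f -` V \<and> smooth_on (\<phi> ` N) (\<psi> \<circ> f \<circ> inv_into U \<phi>)"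
    using loc[of p] by (simp add: std_atlas_def)
qed

lemma smooth_fun_iff:
  fixes A :: "('m::{t2_space,second_countable_topology}, 'a::real_inner) atlas"
  assumes A: "smooth_manifold A"
  shows "smooth_fun A W f \<longleftrightarrow> open W \<and> (\<forall>U \<phi>. (U, \<phi>) \<in> A \<longrightarrow> smooth_on (\<phi> ` (W \<inter> U)) (f \<circ> inv_into U \<phi>))"
    (is "_ \<longleftrightarrow> ?R")
proof
  show "smooth_fun A W f \<Longrightarrow> ?R"
    by (auto simp: smooth_map_on_def std_atlas_def)
  assume R: ?R
  show "smooth_fun A W f"
  proof (rule smooth_funI[OF A])
    show "open W" using R by simp
    fix p assume p: "p \<in> W"
    obtain U \<phi> where U: "(U, \<phi>) \<in> A" "p \<in> U" using chart_at[OF A] .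
    show "\<exists>U \<phi> N. (U, \<phi>) \<in> A \<and> open N \<and> p \<in> N \<and> N \<subseteq> W \<inter> U \<and>
      smooth_on (\<phi> ` N) (f \<circ> inv_into U \<phi>)"
      using R U p chart_open[OF A U(1)] by (intro exI[of _ U] exI[of _ \<phi>] exI[of _ "W \<inter> U"]) auto
  qed
qed

lemma smooth_fun_lift:
  assumes A: "smooth_manifold A" and f: "smooth_fun A W f"
    and h: "smooth_on T (h :: real \<Rightarrow> real)" "f ` W \<subseteq> T"
  shows "smooth_fun A W (\<lambda>p. h (f p))"
  unfolding smooth_fun_iff[OF A]
proof (intro conjI allI impI)
  show W: "open W" using f by (rule smooth_map_on_open)
  fix U \<phi> assume U: "(U, \<phi>) \<in> A"
  have "smooth_on (\<phi> ` (W \<inter> U)) (\<lambda>x. h ((f \<circ> inv_into U \<phi>) x))"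
  proof (rule smooth_on_compose[OF fin_dim_real _ _ h(1)])
    show "open (\<phi> ` (W \<inter> U))"
      by (rule chart_open_image[OF A U]) (use W chart_open[OF A U] in auto)
    show "smooth_on (\<phi> ` (W \<inter> U)) (f \<circ> inv_into U \<phi>)"
      using f U by (simp add: smooth_fun_iff[OF A])
    show "(f \<circ> inv_into U \<phi>) ` \<phi> ` (W \<inter> U) \<subseteq> T"
      using h(2) chart_inv[OF A U] by auto
  qed
  then show "smooth_on (\<phi> ` (W \<inter> U)) ((\<lambda>p. h (f p)) \<circ> inv_into U \<phi>)" by (simp add: comp_def)
qed

lemma smooth_fun_const: "smooth_manifold A \<Longrightarrow> open W \<Longrightarrow> smooth_fun A W (\<lambda>p. c)"
  by (simp add: smooth_map_on_const std_atlas_manifold)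

lemma smooth_fun_add:
  assumes A: "smooth_manifold A" and f: "smooth_fun A W f" "smooth_fun A W f'"
  shows "smooth_fun A W (\<lambda>p. f p + f' p)"
proof -
  have "open (\<phi> ` (W \<inter> U))" if "(U, \<phi>) \<in> A" for U \<phi>
    using f that by (intro chart_open_image[OF A]) (auto intro: chart_open[OF A] smooth_map_on_open)
  then show ?thesis using f by (auto simp: smooth_fun_iff[OF A] comp_def intro!: smooth_on_add)
qed

lemma smooth_fun_mult:
  assumes A: "smooth_manifold A" and f: "smooth_fun A W f" "smooth_fun A W f'"
  shows "smooth_fun A W (\<lambda>p. f p * f' p)"
proof -
  have "open (\<phi> ` (W \<inter> U))" if "(U, \<phi>) \<in> A" for U \<phi>
    using f that by (intro chart_open_image[OF A]) (auto intro: chart_open[OF A] smooth_map_on_open)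
  then show ?thesis using f by (auto simp: smooth_fun_iff[OF A] comp_def intro!: smooth_on_mult)
qed

lemma smooth_fun_sum:
  assumes A: "smooth_manifold A" and "open W"
  shows "(\<And>i. i \<in> I \<Longrightarrow> smooth_fun A W (f i)) \<Longrightarrow> smooth_fun A W (\<lambda>p. \<Sum>i\<in>I. f i p)"
  by (induction I rule: infinite_finite_induct)
    (use assms in \<open>auto intro!: smooth_fun_const smooth_fun_add\<close>)

text \<open>Coordinate functions: a tangent vector applied to them returns its components, and a
  smooth field thereby has smooth components.\<close>

lemma smooth_fun_chart_inner:
  assumes A: "smooth_manifold A" and U: "(U, \<phi>) \<in> A"
  shows "smooth_fun A U (\<lambda>q. \<phi> q \<bullet> b)"
proof (rule smooth_funI[OF A chart_open[OF A U]])
  have oi: "open (\<phi> ` U)"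
    by (rule chart_open_image[OF A U]) (use chart_open[OF A U] in auto)
  have "smooth_on (\<phi> ` U) (\<lambda>x. x \<bullet> b)"
    by (intro smooth_on_bounded_linear bounded_linear_inner_left)
  then have "smooth_on (\<phi> ` U) ((\<lambda>q. \<phi> q \<bullet> b) \<circ> inv_into U \<phi>)"
    by (rule smooth_on_cong_imp[OF _ oi]) (use chart_inv[OF A U] in auto)
  then show "\<exists>U' \<phi>' N. (U', \<phi>') \<in> A \<and> open N \<and> p \<in> N \<and> N \<subseteq> U \<inter> U' \<and>
      smooth_on (\<phi>' ` N) ((\<lambda>q. \<phi> q \<bullet> b) \<circ> inv_into U' \<phi>')" if "p \<in> U" for p
    using U chart_open[OF A U] that by (intro exI[of _ U] exI[of _ \<phi>]) auto
qed

section \<open>Product manifolds\<close>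

lemma inv_into_map_prod:
  assumes "inj_on \<phi> U" "inj_on \<psi> V" "x \<in> \<phi> ` U" "y \<in> \<psi> ` V"
  shows "inv_into (U \<times> V) (map_prod \<phi> \<psi>) (x, y) = (inv_into U \<phi> x, inv_into V \<psi> y)"
proof -
  have "inj_on (map_prod \<phi> \<psi>) (U \<times> V)" using assms by (simp add: map_prod_inj_on)
  then show ?thesis
    using assms by (intro inv_into_f_eq) (auto simp: f_inv_into_f)
qed

lemma product_chartI:
  "(U, \<phi>) \<in> A \<Longrightarrow> (V, \<psi>) \<in> B \<Longrightarrow> (U \<times> V, map_prod \<phi> \<psi>) \<in> product_atlas A B"
  unfolding product_atlas_def by blast

lemma product_chartE:
  assumes "(W, \<xi>) \<in> product_atlas A B"
  obtains U \<phi> V \<psi> where "W = U \<times> V" "\<xi> = map_prod \<phi> \<psi>" "(U, \<phi>) \<in> A" "(V, \<psi>) \<in> B"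
  using assms unfolding product_atlas_def by blast

lemma product_atlas_manifold:
  fixes A :: "('m::{t2_space,second_countable_topology}, 'a::real_inner) atlas"
    and B :: "('n::{t2_space,second_countable_topology}, 'b::real_inner) atlas"
  assumes A: "smooth_manifold A" and B: "smooth_manifold B"
  shows "smooth_manifold (product_atlas A B)"
proof
  note fdA = smooth_manifold_fin_dim[OF A] and fdB = smooth_manifold_fin_dim[OF B]
  show "\<exists>E::('a \<times> 'b) set. finite E \<and> span E = UNIV"
    using fin_dim_prod[OF fdA fdB] by (simp add: fin_dim_def)
  show "(\<Union>(U, \<phi>)\<in>product_atlas A B. U) = UNIV"
  proof -
    have "x \<in> (\<Union>(U, \<phi>)\<in>product_atlas A B. U)" for x
    proof -
      obtain U \<phi> where U: "(U, \<phi>) \<in> A" "fst x \<in> U" using chart_at[OF A] .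
      obtain V \<psi> where V: "(V, \<psi>) \<in> B" "snd x \<in> V" using chart_at[OF B] .
      show ?thesis
        by (rule UN_I[OF product_chartI[OF U(1) V(1)]]) (use U V in \<open>simp add: mem_Times_iff\<close>)
    qed
    then show ?thesis by blast
  qed
  fix W \<xi> assume "(W, \<xi>) \<in> product_atlas A B"
  then obtain U \<phi> V \<psi> where W: "W = U \<times> V" "\<xi> = map_prod \<phi> \<psi>" "(U, \<phi>) \<in> A" "(V, \<psi>) \<in> B"
    by (rule product_chartE)
  note c = smooth_manifold.chart[OF A W(3)] smooth_manifold.chart[OF B W(4)]
  have im: "\<xi> ` W = \<phi> ` U \<times> \<psi> ` V" unfolding W by (intro map_prod_surj_on refl)
  have inv: "inv_into W \<xi> z = (inv_into U \<phi> (fst z), inv_into V \<psi> (snd z))" if "z \<in> \<phi> ` U \<times> \<psi> ` V" for z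
    using that c inv_into_map_prod[of \<phi> U \<psi> V "fst z" "snd z"] by (auto simp: W)
  have "continuous_on W (\<lambda>z. (\<phi> (fst z), \<psi> (snd z)))" unfolding W(1)
    by (intro continuous_on_Pair continuous_on_compose2[OF chart_continuous[OF A W(3)]]
        continuous_on_compose2[OF chart_continuous[OF B W(4)]] continuous_on_fst continuous_on_snd continuous_on_id) auto
  then have c1: "continuous_on W \<xi>" by (rule continuous_on_eq) (auto simp: W)
  have "continuous_on (\<phi> ` U \<times> \<psi> ` V) (\<lambda>z. (inv_into U \<phi> (fst z), inv_into V \<psi> (snd z)))"
  proof (rule continuous_on_Pair)
    show "continuous_on (\<phi> ` U \<times> \<psi> ` V) (\<lambda>z. inv_into U \<phi> (fst z))"
      by (rule continuous_on_compose2[of "\<phi> ` U" "inv_into U \<phi>" _ fst])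
        (use c in \<open>auto intro: continuous_on_fst continuous_on_id\<close>)
    show "continuous_on (\<phi> ` U \<times> \<psi> ` V) (\<lambda>z. inv_into V \<psi> (snd z))"
      by (rule continuous_on_compose2[of "\<psi> ` V" "inv_into V \<psi>" _ snd])
        (use c in \<open>auto intro: continuous_on_snd continuous_on_id\<close>)
  qed
  then have c2: "continuous_on (\<xi> ` W) (inv_into W \<xi>)"
    unfolding im by (rule continuous_on_eq) (simp add: inv)
  show "open W \<and> open (\<xi> ` W) \<and> inj_on \<xi> W \<and> continuous_on W \<xi> \<and> continuous_on (\<xi> ` W) (inv_into W \<xi>)"
    using c c1 c2 unfolding im by (auto simp: W intro!: open_Times map_prod_inj_on)
  fix W' \<xi>' assume "(W', \<xi>') \<in> product_atlas A B"
  then obtain U' \<phi>' V' \<psi>' where W': "W' = U' \<times> V'" "\<xi>' = map_prod \<phi>' \<psi>'" "(U', \<phi>') \<in> A" "(V', \<psi>') \<in> B"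
    by (rule product_chartE)
  have im2: "\<xi> ` (W \<inter> W') = \<phi> ` (U \<inter> U') \<times> \<psi> ` (V \<inter> V')"
    unfolding W W' Times_Int_Times by (intro map_prod_surj_on refl)
  have "open (\<phi> ` (U \<inter> U'))"
    by (rule chart_open_image[OF A W(3)]) (simp_all add: open_Int chart_open[OF A W(3)] chart_open[OF A W'(3)])
  moreover have "open (\<psi> ` (V \<inter> V'))"
    by (rule chart_open_image[OF B W(4)]) (simp_all add: open_Int chart_open[OF B W(4)] chart_open[OF B W'(4)])
  ultimately have o: "open (\<phi> ` (U \<inter> U') \<times> \<psi> ` (V \<inter> V'))" by (rule open_Times)
  have "smooth_on (\<phi> ` (U \<inter> U') \<times> \<psi> ` (V \<inter> V')) (\<lambda>z. ((\<phi>' \<circ> inv_into U \<phi>) (fst z), (\<psi>' \<circ> inv_into V \<psi>) (snd z)))"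
    by (intro smooth_on_Pair[OF fdA fdB o] smooth_on_compose[OF fdA o _ smooth_manifold.compatible[OF A W(3) W'(3)]]
      smooth_on_compose[OF fdB o _ smooth_manifold.compatible[OF B W(4) W'(4)]]
      smooth_on_bounded_linear bounded_linear_fst bounded_linear_snd) auto
  then show "smooth_on (\<xi> ` (W \<inter> W')) (\<xi>' \<circ> inv_into W \<xi>)"
    unfolding im2 by (rule smooth_on_cong_imp[OF _ o]) (auto simp: inv W'(2))
qed

lemma smooth_map_on_fst:
  assumes A: "smooth_manifold A" and B: "smooth_manifold B"
  shows "smooth_map_on (product_atlas A B) A UNIV fst"
proof (rule smooth_map_onI[OF product_atlas_manifold[OF A B] A])
  fix p :: "'a \<times> 'c"
  obtain U \<phi> where U: "(U, \<phi>) \<in> A" "fst p \<in> U" using chart_at[OF A] .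
  obtain V \<psi> where V: "(V, \<psi>) \<in> B" "snd p \<in> V" using chart_at[OF B] .
  have c: "(U \<times> V, map_prod \<phi> \<psi>) \<in> product_atlas A B" using U V by (intro product_chartI)
  note o = chart_open[OF product_atlas_manifold[OF A B] c]
  note oi = chart_open_image[OF product_atlas_manifold[OF A B] c o order_refl]
  have "smooth_on (map_prod \<phi> \<psi> ` (U \<times> V)) (\<phi> \<circ> fst \<circ> inv_into (U \<times> V) (map_prod \<phi> \<psi>))"
    by (rule smooth_on_cong_imp[OF smooth_on_bounded_linear[OF bounded_linear_fst] oi])
      (use chart_inv[OF product_atlas_manifold[OF A B] c] in \<open>auto simp: case_prod_unfold\<close>)
  then show "\<exists>U \<phi> V \<psi> N. (U, \<phi>) \<in> product_atlas A B \<and> (V, \<psi>) \<in> A \<and> open N \<and> p \<in> N \<and>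
      N \<subseteq> UNIV \<inter> U \<inter> fst -` V \<and> smooth_on (\<phi> ` N) (\<psi> \<circ> fst \<circ> inv_into U \<phi>)"
    using U V o c
    by (intro exI[of _ "U \<times> V"] exI[of _ "map_prod \<phi> \<psi>"] exI[of _ U] exI[of _ \<phi>]) (auto simp: mem_Times_iff)
qed (auto intro: continuous_on_fst continuous_on_id)

lemma smooth_map_on_snd:
  assumes A: "smooth_manifold A" and B: "smooth_manifold B"
  shows "smooth_map_on (product_atlas A B) B UNIV snd"
proof (rule smooth_map_onI[OF product_atlas_manifold[OF A B] B])
  fix p :: "'a \<times> 'c"
  obtain U \<phi> where U: "(U, \<phi>) \<in> A" "fst p \<in> U" using chart_at[OF A] .
  obtain V \<psi> where V: "(V, \<psi>) \<in> B" "snd p \<in> V" using chart_at[OF B] .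
  have c: "(U \<times> V, map_prod \<phi> \<psi>) \<in> product_atlas A B" using U V by (intro product_chartI)
  note o = chart_open[OF product_atlas_manifold[OF A B] c]
  note oi = chart_open_image[OF product_atlas_manifold[OF A B] c o order_refl]
  have "smooth_on (map_prod \<phi> \<psi> ` (U \<times> V)) (\<psi> \<circ> snd \<circ> inv_into (U \<times> V) (map_prod \<phi> \<psi>))"
    by (rule smooth_on_cong_imp[OF smooth_on_bounded_linear[OF bounded_linear_snd] oi])
      (use chart_inv[OF product_atlas_manifold[OF A B] c] in \<open>auto simp: case_prod_unfold\<close>)
  then show "\<exists>U \<phi> V \<psi> N. (U, \<phi>) \<in> product_atlas A B \<and> (V, \<psi>) \<in> B \<and> open N \<and> p \<in> N \<and>
      N \<subseteq> UNIV \<inter> U \<inter> snd -` V \<and> smooth_on (\<phi> ` N) (\<psi> \<circ> snd \<circ> inv_into U \<phi>)"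
    using U V o c
    by (intro exI[of _ "U \<times> V"] exI[of _ "map_prod \<phi> \<psi>"] exI[of _ V] exI[of _ \<psi>]) (auto simp: mem_Times_iff)
qed (auto intro: continuous_on_snd continuous_on_id)

lemma smooth_map_on_Pair:
  fixes A :: "('m::{t2_space,second_countable_topology}, 'a::real_inner) atlas"
    and B :: "('n::{t2_space,second_countable_topology}, 'b::real_inner) atlas"
    and C :: "('k::{t2_space,second_countable_topology}, 'c::real_inner) atlas"
  assumes A: "smooth_manifold A" and B: "smooth_manifold B" and C: "smooth_manifold C"
    and F: "smooth_map_on A B W F" and G: "smooth_map_on A C W G"
  shows "smooth_map_on A (product_atlas B C) W (\<lambda>p. (F p, G p))"
proof (rule smooth_map_onI[OF A product_atlas_manifold[OF B C]])
  have oW: "open W" and cF: "continuous_on W F" and cG: "continuous_on W G"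
    using F G by (auto simp: smooth_map_on_def)
  then show "open W" "continuous_on W (\<lambda>p. (F p, G p))" by (auto intro: continuous_on_Pair)
  fix p assume p: "p \<in> W"
  obtain U \<phi> where U: "(U, \<phi>) \<in> A" "p \<in> U" using chart_at[OF A] .
  obtain V \<psi> where V: "(V, \<psi>) \<in> B" "F p \<in> V" using chart_at[OF B] .
  obtain X \<xi> where X: "(X, \<xi>) \<in> C" "G p \<in> X" using chart_at[OF C] .
  define N where "N = (W \<inter> F -` V) \<inter> (W \<inter> G -` X) \<inter> U"
  have oN: "open N" unfolding N_def
    by (intro open_Int open_Int_vimage oW cF cG chart_open[OF A U(1)] chart_open[OF B V(1)] chart_open[OF C X(1)])
  have oi: "open (\<phi> ` N)" by (rule chart_open_image[OF A U(1) oN]) (auto simp: N_def)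
  have "smooth_on (\<phi> ` N) (\<lambda>x. ((\<psi> \<circ> F \<circ> inv_into U \<phi>) x, (\<xi> \<circ> G \<circ> inv_into U \<phi>) x))"
    by (intro smooth_on_Pair smooth_manifold_fin_dim[OF B] smooth_manifold_fin_dim[OF C] oi
        smooth_map_onD[OF F U(1) V(1)] smooth_map_onD[OF G U(1) X(1)]) (auto simp: N_def)
  then have "smooth_on (\<phi> ` N) (map_prod \<psi> \<xi> \<circ> (\<lambda>p. (F p, G p)) \<circ> inv_into U \<phi>)"
    by (simp add: comp_def)
  moreover have "(V \<times> X, map_prod \<psi> \<xi>) \<in> product_atlas B C" using V X by (intro product_chartI)
  ultimately show "\<exists>U \<phi> V \<psi> N. (U, \<phi>) \<in> A \<and> (V, \<psi>) \<in> product_atlas B C \<and> open N \<and> p \<in> N \<and>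
      N \<subseteq> W \<inter> U \<inter> (\<lambda>p. (F p, G p)) -` V \<and>
      smooth_on (\<phi> ` N) (\<psi> \<circ> (\<lambda>p. (F p, G p)) \<circ> inv_into U \<phi>)"
    using U V X oN p
    by (intro exI[of _ U] exI[of _ \<phi>] exI[of _ "V \<times> X"] exI[of _ "map_prod \<psi> \<xi>"] exI[of _ N]) (auto simp: N_def)
qed

section \<open>Tangent vectors in coordinates\<close>

text \<open>The directional derivative in a chart, with the same default 0 as
  \<open>velocity\<close> on functions that are not smooth near \<open>p\<close>, so that the two
  can be equal as functions.\<close>

definition coord_vector ::
  "('m::topological_space, 'a::real_inner) atlas \<Rightarrow> 'm set \<Rightarrow> ('m \<Rightarrow> 'a) \<Rightarrow> 'm \<Rightarrow> 'a \<Rightarrow> 'm tvec" where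
  "coord_vector A U \<phi> p w =
    (\<lambda>f. if smooth_near A p f then frechet_derivative (f \<circ> inv_into U \<phi>) (at (\<phi> p)) w else 0)"

lemma smooth_near_compose:
  fixes A :: "('m::{t2_space,second_countable_topology}, 'a::real_inner) atlas"
    and B :: "('n::{t2_space,second_countable_topology}, 'b::real_inner) atlas"
  assumes A: "smooth_manifold A" and B: "smooth_manifold B"
    and F: "smooth_map_on A B W F" "p \<in> W" and f: "smooth_near B (F p) f"
  shows "smooth_near A p (\<lambda>q. f (F q))"
proof -
  obtain W' where W': "F p \<in> W'" "smooth_fun B W' f" using f by (auto simp: smooth_near_def)
  have "smooth_fun A (W \<inter> F -` W') (\<lambda>q. f (F q))"
    by (rule smooth_map_on_compose[OF A B std_atlas_manifold F(1) W'(2)])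
  then show ?thesis using W' F(2) unfolding smooth_near_def by (intro exI[of _ "W \<inter> F -` W'"]) auto
qed

lemma smooth_near_cong:
  fixes A :: "('m::{t2_space,second_countable_topology}, 'a::real_inner) atlas"
  assumes A: "smooth_manifold A" and N: "open N" "p \<in> N" "\<And>q. q \<in> N \<Longrightarrow> f q = f' q" and f: "smooth_near A p f"
  shows "smooth_near A p f'"
proof -
  obtain W where W: "p \<in> W" "smooth_fun A W f" using f by (auto simp: smooth_near_def)
  have "smooth_fun A (W \<inter> N) f"
    by (rule smooth_map_on_subset[OF W(2)]) (use smooth_map_on_open[OF W(2)] N in auto)
  then have "smooth_fun A (W \<inter> N) f'"
    by (rule smooth_map_on_cong[OF A std_atlas_manifold]) (use N in auto)
  then show ?thesis using W N unfolding smooth_near_def by blast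
qed

lemma smooth_near_differentiable:
  fixes A :: "('m::{t2_space,second_countable_topology}, 'a::real_inner) atlas"
  assumes A: "smooth_manifold A" and U: "(U, \<phi>) \<in> A" "p \<in> U" and f: "smooth_near A p f"
  shows "(f \<circ> inv_into U \<phi>) differentiable (at (\<phi> p))"
proof -
  obtain W where W: "p \<in> W" "smooth_fun A W f" using f by (auto simp: smooth_near_def)
  then have "smooth_on (\<phi> ` (W \<inter> U)) (f \<circ> inv_into U \<phi>)"
    using U by (simp add: smooth_fun_iff[OF A])
  then show ?thesis by (rule smooth_on_differentiable) (use U W in auto)
qed

lemma velocity_coord:
  fixes A :: "('m::{t2_space,second_countable_topology}, 'a::real_inner) atlas"
  assumes A: "smooth_manifold A" and c: "smooth_map_on std_atlas A I c" "0 \<in> I" and U: "(U, \<phi>) \<in> A" "c 0 \<in> U"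
  shows "velocity A c = coord_vector A U \<phi> (c 0) (frechet_derivative (\<phi> \<circ> c) (at 0) 1)"
proof
  fix f
  define J where "J = I \<inter> c -` U"
  have J: "open J" "0 \<in> J" unfolding J_def
    using c U chart_open[OF A U(1)] by (auto intro: open_Int_vimage smooth_map_on_open smooth_map_on_continuous)
  have s: "(UNIV, id) \<in> (std_atlas :: (real, real) atlas)" by (simp add: std_atlas_def)
  have "smooth_on (id ` J) (\<phi> \<circ> c \<circ> inv_into UNIV id)"
    by (rule smooth_map_onD[OF c(1) s U(1)]) (auto simp: J_def)
  then have d: "(\<phi> \<circ> c) differentiable (at 0)"
    using J by (auto simp: inv_id intro: smooth_on_differentiable)
  show "velocity A c f = coord_vector A U \<phi> (c 0) (frechet_derivative (\<phi> \<circ> c) (at 0) 1) f"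
  proof (cases "smooth_near A (c 0) f")
    case True
    let ?L = "frechet_derivative (f \<circ> inv_into U \<phi>) (at (\<phi> (c 0))) \<circ> frechet_derivative (\<phi> \<circ> c) (at 0)"
    have df: "(f \<circ> inv_into U \<phi>) differentiable (at (\<phi> (c 0)))"
      by (rule smooth_near_differentiable[OF A U True])
    have "((f \<circ> inv_into U \<phi>) \<circ> (\<phi> \<circ> c) has_derivative ?L) (at 0)"
      using d df by (intro diff_chain_at) (simp_all flip: frechet_derivative_works)
    then have L: "(f \<circ> c has_derivative ?L) (at 0)"
      by (rule has_derivative_transform_within_open[OF _ J])
        (use chart_inv[OF A U(1)] in \<open>auto simp: J_def\<close>)
    \<comment> \<open>A linear map on the reals is multiplication by its value at 1. This turns the
      Frechet derivative into the derivative that \<open>deriv\<close> refers to.\<close>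
    have "linear ?L" using L by (rule has_derivative_linear)
    then have "x * ?L 1 = ?L x" for x
      by (metis linear_scale mult.right_neutral real_scaleR_def)
    then have "(f \<circ> c has_field_derivative ?L 1) (at 0)"
      using has_derivative_imp_has_field_derivative[OF L] by metis
    then have "deriv (f \<circ> c) 0 = ?L 1" by (rule DERIV_imp_deriv)
    then show ?thesis using True by (simp add: velocity_def coord_vector_def)
  qed (simp add: velocity_def coord_vector_def)
qed

text \<open>The witness is the curve that is the straight line \<open>\<phi> p + t w\<close> in the
  chart. Together with \<open>velocity_coord\<close> this identifies the tangent space with the
  model space, which gives access to its linear structure.\<close>

lemma coord_vector_tangent:
  fixes A :: "('m::{t2_space,second_countable_topology}, 'a::real_inner) atlas"
  assumes A: "smooth_manifold A" and U: "(U, \<phi>) \<in> A" "p \<in> U"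
  shows "coord_vector A U \<phi> p w \<in> tangent_space A p"
proof -
  \<comment> \<open>The times at which the line stays in the image of the chart.\<close>
  define I where "I = (\<lambda>t::real. \<phi> p + t *\<^sub>R w) -` (\<phi> ` U)"
  define c where "c t = inv_into U \<phi> (\<phi> p + t *\<^sub>R w)" for t
  note ch = smooth_manifold.chart[OF A U(1)]
  have cont: "continuous_on UNIV (\<lambda>t::real. \<phi> p + t *\<^sub>R w)" by (intro continuous_intros)
  have I: "open I" "0 \<in> I" unfolding I_def using ch U by (auto intro: open_vimage[OF _ cont])
  have c0: "c 0 = p" by (simp add: c_def chart_inv[OF A U])
  have cI: "c t \<in> U" "\<phi> (c t) = \<phi> p + t *\<^sub>R w" if "t \<in> I" for t
    using that by (auto simp: c_def I_def intro: inv_into_into f_inv_into_f)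
  have aff: "smooth_on I (\<lambda>t. \<phi> p + t *\<^sub>R w)"
    by (intro smooth_on_add I smooth_on_const smooth_on_bounded_linear bounded_linear_scaleR_left)
  have s: "smooth_map_on std_atlas A I c"
  proof (rule smooth_map_onI[OF std_atlas_manifold A I(1)])
    have "continuous_on (\<phi> ` U) (inv_into U \<phi>)" using ch by blast
    then show "continuous_on I c" unfolding c_def
      by (rule continuous_on_compose2[OF _ continuous_on_subset[OF cont]]) (auto simp: I_def)
    fix t assume "t \<in> I"
    have "smooth_on I (\<phi> \<circ> c)"
      by (rule smooth_on_cong_imp[OF aff I(1)]) (simp add: cI)
    then have "smooth_on (id ` I) (\<phi> \<circ> c \<circ> inv_into UNIV id)" by (simp add: inv_id)
    then show "\<exists>U' \<phi>' V \<psi> N. (U', \<phi>') \<in> (std_atlas :: (real, real) atlas) \<and> (V, \<psi>) \<in> A \<and> open N \<and> t \<in> N \<and>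
        N \<subseteq> I \<inter> U' \<inter> c -` V \<and> smooth_on (\<phi>' ` N) (\<psi> \<circ> c \<circ> inv_into U' \<phi>')"
      using U I \<open>t \<in> I\<close> cI
      by (intro exI[of _ UNIV] exI[of _ id] exI[of _ U] exI[of _ \<phi>] exI[of _ I]) (auto simp: std_atlas_def)
  qed
  have "(\<phi> \<circ> c has_derivative (\<lambda>t. t *\<^sub>R w)) (at 0)"
  proof (rule has_derivative_transform_within_open[OF _ I])
    show "((\<lambda>t. \<phi> p + t *\<^sub>R w) has_derivative (\<lambda>t. t *\<^sub>R w)) (at 0)"
      by (auto intro!: derivative_eq_intros)
  qed (simp add: cI)
  then have "frechet_derivative (\<phi> \<circ> c) (at 0) = (\<lambda>t. t *\<^sub>R w)"
    by (rule frechet_derivative_at[symmetric])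
  then have "velocity A c = coord_vector A U \<phi> p w"
    using velocity_coord[OF A s I(2) U(1)] U c0 by simp
  then show ?thesis unfolding tangent_space_def using s I c0 by (intro CollectI exI[of _ c] exI[of _ I]) auto
qed

lemma tangent_space_coord:
  fixes A :: "('m::{t2_space,second_countable_topology}, 'a::real_inner) atlas"
  assumes A: "smooth_manifold A" and U: "(U, \<phi>) \<in> A" "p \<in> U" and v: "v \<in> tangent_space A p"
  obtains w where "v = coord_vector A U \<phi> p w"
proof -
  obtain c I where c: "v = velocity A c" "0 \<in> I" "smooth_map_on std_atlas A I c" "c 0 = p"
    using v by (auto simp: tangent_space_def)
  show ?thesis using velocity_coord[OF A c(3,2) U(1)] U c that by auto
qed

lemma coord_vector_chart_inner:
  fixes A :: "('m::{t2_space,second_countable_topology}, 'a::real_inner) atlas"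
  assumes A: "smooth_manifold A" and U: "(U, \<phi>) \<in> A" "p \<in> U"
  shows "coord_vector A U \<phi> p w (\<lambda>q. \<phi> q \<bullet> b) = w \<bullet> b"
proof -
  have n: "smooth_near A p (\<lambda>q. \<phi> q \<bullet> b)"
    using smooth_fun_chart_inner[OF A U(1)] U(2) by (auto simp: smooth_near_def)
  have o: "open (\<phi> ` U)" using smooth_manifold.chart[OF A U(1)] by simp
  have "((\<lambda>q. \<phi> q \<bullet> b) \<circ> inv_into U \<phi> has_derivative (\<lambda>x. x \<bullet> b)) (at (\<phi> p))"
  proof (rule has_derivative_transform_within_open[OF _ o])
    show "((\<lambda>x. x \<bullet> b) has_derivative (\<lambda>x. x \<bullet> b)) (at (\<phi> p))"
      by (intro bounded_linear_imp_has_derivative bounded_linear_inner_left)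
  qed (use U chart_inv[OF A U(1)] in auto)
  then show ?thesis using n by (simp add: coord_vector_def flip: frechet_derivative_at)
qed

text \<open>Testing on the coordinate function \<open>\<phi> q \<bullet> w\<close> yields
  \<open>w \<bullet> w\<close>. In the Gram-Schmidt process this shows that the new field has no
  zeros.\<close>

lemma coord_vector_inj:
  fixes A :: "('m::{t2_space,second_countable_topology}, 'a::real_inner) atlas"
  assumes A: "smooth_manifold A" and U: "(U, \<phi>) \<in> A" "p \<in> U"
    and eq: "coord_vector A U \<phi> p w = (\<lambda>_. 0)"
  shows "w = 0"
  using coord_vector_chart_inner[OF A U, of w w] eq by simp

lemma coord_vector_sum:
  fixes A :: "('m::{t2_space,second_countable_topology}, 'a::real_inner) atlas"
  assumes A: "smooth_manifold A" and U: "(U, \<phi>) \<in> A" "p \<in> U"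
  shows "coord_vector A U \<phi> p (\<Sum>i\<in>I. c i *\<^sub>R w i) = (\<lambda>f. \<Sum>i\<in>I. c i * coord_vector A U \<phi> p (w i) f)"
proof
  fix f
  show "coord_vector A U \<phi> p (\<Sum>i\<in>I. c i *\<^sub>R w i) f = (\<Sum>i\<in>I. c i * coord_vector A U \<phi> p (w i) f)"
  proof (cases "smooth_near A p f")
    case True
    then have "linear (frechet_derivative (f \<circ> inv_into U \<phi>) (at (\<phi> p)))"
      by (intro linear_frechet_derivative smooth_near_differentiable[OF A U])
    then show ?thesis using True by (simp add: coord_vector_def linear_sum linear_scale)
  qed (simp add: coord_vector_def)
qed

text \<open>Curves on a manifold cannot be added, so the combination is formed in coordinates, where
  a single straight line realises it.\<close>

lemma tangent_sum:
  fixes A :: "('m::{t2_space,second_countable_topology}, 'a::real_inner) atlas"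
  assumes A: "smooth_manifold A" and v: "\<And>i. i \<in> I \<Longrightarrow> v i \<in> tangent_space A p"
  shows "(\<lambda>f. \<Sum>i\<in>I. c i * v i f) \<in> tangent_space A p"
proof -
  obtain U \<phi> where U: "(U, \<phi>) \<in> A" "p \<in> U" using chart_at[OF A] .
  have "\<exists>w. \<forall>i\<in>I. v i = coord_vector A U \<phi> p (w i)"
    using tangent_space_coord[OF A U v] by (intro bchoice ballI) blast
  then obtain w where "\<And>i. i \<in> I \<Longrightarrow> v i = coord_vector A U \<phi> p (w i)" by blast
  then have "(\<lambda>f. \<Sum>i\<in>I. c i * v i f) = coord_vector A U \<phi> p (\<Sum>i\<in>I. c i *\<^sub>R w i)"
    by (simp add: coord_vector_sum[OF A U])
  then show ?thesis using coord_vector_tangent[OF A U] by simp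
qed

lemma tangent_scale:
  fixes A :: "('m::{t2_space,second_countable_topology}, 'a::real_inner) atlas"
  assumes A: "smooth_manifold A" and v: "v \<in> tangent_space A p"
  shows "(\<lambda>f. c * v f) \<in> tangent_space A p"
  using tangent_sum[OF A, of "{()}" "\<lambda>_. v" p "\<lambda>_. c"] v by simp

lemma tangent_add:
  fixes A :: "('m::{t2_space,second_countable_topology}, 'a::real_inner) atlas"
  assumes A: "smooth_manifold A" and v: "v \<in> tangent_space A p" "v' \<in> tangent_space A p"
  shows "(\<lambda>f. v f + v' f) \<in> tangent_space A p"
  using tangent_sum[OF A, of "{True, False}" "\<lambda>b. if b then v else v'" p "\<lambda>_. 1"] v by simp

lemma tangent_not_smooth: "v \<in> tangent_space A p \<Longrightarrow> \<not> smooth_near A p f \<Longrightarrow> v f = 0"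
  by (auto simp: tangent_space_def velocity_def)

text \<open>A curve through \<open>p\<close> stays in \<open>N\<close> for small times, and
  smoothness near \<open>p\<close> is a local property, so the default case of
  \<open>velocity\<close> is also respected.\<close>

lemma tangent_local:
  fixes A :: "('m::{t2_space,second_countable_topology}, 'a::real_inner) atlas"
  assumes A: "smooth_manifold A" and v: "v \<in> tangent_space A p"
    and N: "open N" "p \<in> N" "\<And>q. q \<in> N \<Longrightarrow> f q = f' q"
  shows "v f = v f'"
proof -
  obtain c I where c: "v = velocity A c" "0 \<in> I" "smooth_map_on std_atlas A I c" "c 0 = p"
    using v by (auto simp: tangent_space_def)
  have "smooth_near A p f = smooth_near A p f'"
    using smooth_near_cong[OF A N] smooth_near_cong[OF A N(1,2), of f' f] N(3) by auto
  moreover have "deriv (f \<circ> c) 0 = deriv (f' \<circ> c) 0"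
  proof (rule deriv_cong_ev)
    have "open (I \<inter> c -` N)" "0 \<in> I \<inter> c -` N"
      using c N by (auto intro: open_Int_vimage smooth_map_on_open smooth_map_on_continuous)
    then show "\<forall>\<^sub>F x in nhds 0. (f \<circ> c) x = (f' \<circ> c) x"
      using N(3) by (auto simp: eventually_nhds intro!: exI[of _ "I \<inter> c -` N"])
  qed simp
  ultimately show ?thesis using c by (simp add: velocity_def)
qed

text \<open>Smoothness of the \<open>u i\<close> matters: tangent vectors are 0 on functions not
  smooth near \<open>p\<close>, so additivity may fail when non-smooth summands have a smooth
  sum.\<close>

lemma tangent_fun_sum:
  fixes A :: "('m::{t2_space,second_countable_topology}, 'a::real_inner) atlas"
  assumes A: "smooth_manifold A" and v: "v \<in> tangent_space A p"
    and u: "\<And>i. i \<in> I \<Longrightarrow> smooth_fun A W (u i)" and W: "open W" "p \<in> W"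
  shows "v (\<lambda>q. \<Sum>i\<in>I. u i q * c i) = (\<Sum>i\<in>I. v (u i) * c i)"
proof -
  obtain U \<phi> where U: "(U, \<phi>) \<in> A" "p \<in> U" using chart_at[OF A] .
  obtain w where w: "v = coord_vector A U \<phi> p w" using tangent_space_coord[OF A U v] .
  have n: "smooth_near A p (u i)" if "i \<in> I" for i
    using u[OF that] W by (auto simp: smooth_near_def)
  have "smooth_fun A W (\<lambda>q. \<Sum>i\<in>I. u i q * c i)"
    using W u by (intro smooth_fun_sum[OF A] smooth_fun_mult[OF A] smooth_fun_const[OF A])
  then have n': "smooth_near A p (\<lambda>q. \<Sum>i\<in>I. u i q * c i)"
    using W by (auto simp: smooth_near_def)
  have "((\<lambda>x. \<Sum>i\<in>I. (u i \<circ> inv_into U \<phi>) x * c i) has_derivative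
      (\<lambda>x. \<Sum>i\<in>I. frechet_derivative (u i \<circ> inv_into U \<phi>) (at (\<phi> p)) x * c i)) (at (\<phi> p))"
    by (intro has_derivative_sum has_derivative_mult_left frechet_derivative_works[THEN iffD1]
        smooth_near_differentiable[OF A U n])
  from fun_cong[OF frechet_derivative_at[OF this], of w] show ?thesis
    using n n' unfolding w by (simp add: coord_vector_def comp_def)
qed

lemma tangent_const:
  fixes A :: "('m::{t2_space,second_countable_topology}, 'a::real_inner) atlas"
  assumes A: "smooth_manifold A" and v: "v \<in> tangent_space A p"
  shows "v (\<lambda>q. c) = 0"
proof -
  obtain k I where "v = velocity A k" using v by (auto simp: tangent_space_def)
  then show ?thesis by (simp add: velocity_def comp_def)
qed

lemma pushforward_tangent:
  fixes A :: "('m::{t2_space,second_countable_topology}, 'a::real_inner) atlas"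
    and B :: "('n::{t2_space,second_countable_topology}, 'b::real_inner) atlas"
  assumes A: "smooth_manifold A" and B: "smooth_manifold B"
    and F: "smooth_map_on A B W F" "p \<in> W" and v: "v \<in> tangent_space A p"
  shows "pushforward B F p v \<in> tangent_space B (F p)"
proof -
  obtain c I where c: "v = velocity A c" "0 \<in> I" "smooth_map_on std_atlas A I c" "c 0 = p"
    using v by (auto simp: tangent_space_def)
  have s: "smooth_map_on std_atlas B (I \<inter> c -` W) (\<lambda>t. F (c t))"
    by (rule smooth_map_on_compose[OF std_atlas_manifold A B c(3) F(1)])
  have "pushforward B F p v = velocity B (\<lambda>t. F (c t))"
    using smooth_near_compose[OF A B F] c
    by (auto simp: pushforward_def velocity_def fun_eq_iff comp_def)
  then show ?thesis unfolding tangent_space_def using s c F(2)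
    by (intro CollectI exI[of _ "\<lambda>t. F (c t)"] exI[of _ "I \<inter> c -` W"]) auto
qed

lemma pushforward_pushforward:
  fixes B :: "('n::{t2_space,second_countable_topology}, 'b::real_inner) atlas"
    and C :: "('k::{t2_space,second_countable_topology}, 'c::real_inner) atlas"
  assumes B: "smooth_manifold B" and C: "smooth_manifold C"
    and G: "smooth_map_on B C W G" "F p \<in> W"
  shows "pushforward C G (F p) (pushforward B F p v) = pushforward C (\<lambda>q. G (F q)) p v"
  using smooth_near_compose[OF B C G] by (auto simp: pushforward_def fun_eq_iff comp_def)

text \<open>The case distinction in \<open>pushforward\<close> changes nothing, because tangent
  vectors already vanish on functions that are not smooth near \<open>p\<close>.\<close>

lemma pushforward_ident:
  assumes "v \<in> tangent_space A p"
  shows "pushforward A (\<lambda>q. q) p v = v"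
  using tangent_not_smooth[OF assms] by (auto simp: pushforward_def fun_eq_iff comp_def)

lemma pushforward_sum:
  "pushforward B F p (\<lambda>f. \<Sum>i\<in>I. c i * v i f) = (\<lambda>f. \<Sum>i\<in>I. c i * pushforward B F p (v i) f)"
  by (auto simp: pushforward_def fun_eq_iff)

lemma tangent_expand:
  fixes A :: "('m::{t2_space,second_countable_topology}, 'a::real_inner) atlas"
  assumes A: "smooth_manifold A" and U: "(U, \<phi>) \<in> A" "p \<in> U" and v: "v \<in> tangent_space A p" and E: "onb E"
  shows "v = coord_vector A U \<phi> p (\<Sum>b\<in>E. v (\<lambda>q. \<phi> q \<bullet> b) *\<^sub>R b)"
proof -
  obtain w where w: "v = coord_vector A U \<phi> p w" using tangent_space_coord[OF A U v] .
  show ?thesis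
    using onb_expand[OF E, of w] by (simp add: w coord_vector_chart_inner[OF A U])
qed

section \<open>Smooth fields\<close>

lemma field_alongD:
  assumes "field_along A B F U Z"
  shows "open U" "p \<in> U \<Longrightarrow> Z p \<in> tangent_space B (F p)"
    "smooth_fun B W f \<Longrightarrow> smooth_fun A (U \<inter> F -` W) (\<lambda>p. Z p f)"
  using assms by (auto simp: field_along_def)

lemma field_along_sum:
  fixes A :: "('m::{t2_space,second_countable_topology}, 'a::real_inner) atlas"
    and B :: "('n::{t2_space,second_countable_topology}, 'b::real_inner) atlas"
  assumes A: "smooth_manifold A" and B: "smooth_manifold B" and U: "open U" and F: "continuous_on U F"
    and u: "\<And>i. i \<in> I \<Longrightarrow> smooth_fun A U (u i)" and Z: "\<And>i. i \<in> I \<Longrightarrow> field_along A B F U (Z i)"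
  shows "field_along A B F U (\<lambda>q f. \<Sum>i\<in>I. u i q * Z i q f)"
  unfolding field_along_def
proof (intro conjI ballI allI impI U)
  show "(\<lambda>f. \<Sum>i\<in>I. u i p * Z i p f) \<in> tangent_space B (F p)" if "p \<in> U" for p
    using that by (intro tangent_sum[OF B] field_alongD(2)[OF Z])
  fix W and f :: "'n \<Rightarrow> real" assume f: "smooth_fun B W f"
  have o: "open (U \<inter> F -` W)" using U F smooth_map_on_open[OF f] by (rule open_Int_vimage)
  show "smooth_fun A (U \<inter> F -` W) (\<lambda>p. \<Sum>i\<in>I. u i p * Z i p f)"
    by (intro smooth_fun_sum[OF A o] smooth_fun_mult[OF A] field_alongD(3)[OF Z f] smooth_map_on_subset[OF u o]) auto
qed

lemma field_along_scale:
  fixes A :: "('m::{t2_space,second_countable_topology}, 'a::real_inner) atlas"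
    and B :: "('n::{t2_space,second_countable_topology}, 'b::real_inner) atlas"
  assumes A: "smooth_manifold A" and B: "smooth_manifold B" and F: "continuous_on U F"
    and u: "smooth_fun A U u" and Z: "field_along A B F U Z"
  shows "field_along A B F U (\<lambda>q f. u q * Z q f)"
  using field_along_sum[OF A B field_alongD(1)[OF Z] F, of "{()}" "\<lambda>_. u" "\<lambda>_. Z"] assms by simp

lemma field_along_add:
  fixes A :: "('m::{t2_space,second_countable_topology}, 'a::real_inner) atlas"
    and B :: "('n::{t2_space,second_countable_topology}, 'b::real_inner) atlas"
  assumes A: "smooth_manifold A" and B: "smooth_manifold B" and F: "continuous_on U F"
    and Z: "field_along A B F U Z" "field_along A B F U Z'"
  shows "field_along A B F U (\<lambda>q f. Z q f + Z' q f)"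
  using field_along_sum[OF A B field_alongD(1)[OF Z(1)] F, of "{True, False}" "\<lambda>_ _. 1" "\<lambda>b. if b then Z else Z'"]
    Z smooth_fun_const[OF A field_alongD(1)[OF Z(1)]] by simp

text \<open>Supplies the sections on which \<open>induced\<close> prescribes the connection.
  \<open>Y\<close> is global, as left invariant fields are.\<close>

lemma field_along_compose:
  fixes A :: "('m::{t2_space,second_countable_topology}, 'a::real_inner) atlas"
    and B :: "('n::{t2_space,second_countable_topology}, 'b::real_inner) atlas"
  assumes A: "smooth_manifold A" and B: "smooth_manifold B" and F: "smooth_map_on A B UNIV F"
    and Y: "vector_field B UNIV Y" and U: "open U"
  shows "field_along A B F U (Y \<circ> F)"
  unfolding field_along_def
proof (intro conjI ballI allI impI U)
  show "(Y \<circ> F) p \<in> tangent_space B (F p)" for p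
    using field_alongD(2)[OF Y, of "F p"] by simp
  fix W and f :: "'n \<Rightarrow> real" assume f: "smooth_fun B W f"
  have "smooth_fun B W (\<lambda>p. Y p f)" using field_alongD(3)[OF Y f] by simp
  from smooth_map_on_compose[OF A B std_atlas_manifold F this]
  have "smooth_fun A (F -` W) (\<lambda>p. (Y \<circ> F) p f)" by simp
  moreover have "open (U \<inter> F -` W)"
    using U F f by (intro open_Int_vimage) (auto intro: continuous_on_subset smooth_map_on_open smooth_map_on_continuous)
  ultimately show "smooth_fun A (U \<inter> F -` W) (\<lambda>p. (Y \<circ> F) p f)"
    by (rule smooth_map_on_subset) auto
qed

lemma coord_vector_field:
  fixes A :: "('m::{t2_space,second_countable_topology}, 'a::real_inner) atlas"
  assumes A: "smooth_manifold A" and U: "(U, \<phi>) \<in> A"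
  shows "vector_field A U (\<lambda>q. coord_vector A U \<phi> q b)"
  unfolding field_along_def
proof (intro conjI ballI allI impI)
  show oU: "open U" by (rule chart_open[OF A U])
  show "coord_vector A U \<phi> p b \<in> tangent_space A (id p)" if "p \<in> U" for p
    using coord_vector_tangent[OF A U that] by simp
  fix W and f :: "'m \<Rightarrow> real" assume f: "smooth_fun A W f"
  have o: "open (U \<inter> W)" using oU smooth_map_on_open[OF f] by auto
  have oi: "open (\<phi> ` (U \<inter> W))" by (rule chart_open_image[OF A U o]) auto
  have "smooth_on (\<phi> ` (W \<inter> U)) (f \<circ> inv_into U \<phi>)" using f U by (simp add: smooth_fun_iff[OF A])
  then have "smooth_on (\<phi> ` (U \<inter> W)) (\<lambda>x. frechet_derivative (f \<circ> inv_into U \<phi>) (at x) b)"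
    by (simp add: Int_commute smooth_on_frechet)
  then have s: "smooth_on (\<phi> ` (U \<inter> W)) ((\<lambda>p. coord_vector A U \<phi> p b f) \<circ> inv_into U \<phi>)"
  proof (rule smooth_on_cong_imp[OF _ oi])
    fix x assume "x \<in> \<phi> ` (U \<inter> W)"
    then obtain q where q: "q \<in> U" "q \<in> W" "x = \<phi> q" by auto
    then have "smooth_near A q f" using f by (auto simp: smooth_near_def)
    then show "frechet_derivative (f \<circ> inv_into U \<phi>) (at x) b = ((\<lambda>p. coord_vector A U \<phi> p b f) \<circ> inv_into U \<phi>) x"
      using q chart_inv[OF A U] by (simp add: coord_vector_def)
  qed
  show "smooth_fun A (U \<inter> id -` W) (\<lambda>p. coord_vector A U \<phi> p b f)"
  proof (rule smooth_funI[OF A])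
    fix p assume "p \<in> U \<inter> id -` W"
    then show "\<exists>U' \<phi>' N. (U', \<phi>') \<in> A \<and> open N \<and> p \<in> N \<and> N \<subseteq> (U \<inter> id -` W) \<inter> U' \<and>
        smooth_on (\<phi>' ` N) ((\<lambda>p. coord_vector A U \<phi> p b f) \<circ> inv_into U' \<phi>')"
      using U o s by (intro exI[of _ U] exI[of _ \<phi>] exI[of _ "U \<inter> W"]) auto
  qed (use o in simp)
qed

text \<open>A smooth field applied to a smooth family of functions, the parameter being the base
  point. In charts, \<open>Z p (K p)\<close> is the partial derivative in the second variable of one
  jointly smooth function, with smoothly varying point and direction. Joint smoothness is required
  only near the graph of \<open>F\<close>. The two uses are left invariant fields (\<open>F\<close>
  constant) and the pulled back Maurer-Cartan form (\<open>F\<close> the identity).\<close>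

lemma smooth_fun_field_apply:
  fixes A :: "('m::{t2_space,second_countable_topology}, 'a::real_inner) atlas"
    and B :: "('n::{t2_space,second_countable_topology}, 'b::real_inner) atlas"
  assumes A: "smooth_manifold A" and B: "smooth_manifold B"
    and Z: "field_along A B F U Z" and F: "smooth_map_on A B U F"
    and K: "smooth_fun (product_atlas A B) N (\<lambda>(p, q). K p q)" and N: "\<And>p. p \<in> U \<Longrightarrow> (p, F p) \<in> N"
  shows "smooth_fun A U (\<lambda>p. Z p (K p))"
proof (rule smooth_funI[OF A field_alongD(1)[OF Z]])
  note AB = product_atlas_manifold[OF A B]
  fix p assume p: "p \<in> U"
  obtain V \<phi> where V: "(V, \<phi>) \<in> A" "p \<in> V" using chart_at[OF A] .
  obtain V' \<psi> where V': "(V', \<psi>) \<in> B" "F p \<in> V'" using chart_at[OF B] .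
  obtain E :: "'b set" where E: "onb E" using onb_exists[OF smooth_manifold_fin_dim[OF B]] .
  define O1 where "O1 = (U \<inter> F -` V') \<inter> V"
  have oO: "open O1" "p \<in> O1" "O1 \<subseteq> U \<inter> V" "O1 \<subseteq> U \<inter> V \<inter> F -` V'"
    unfolding O1_def using p V V'
    by (auto intro: open_Int open_Int_vimage[OF smooth_map_on_open[OF F] smooth_map_on_continuous[OF F]]
        chart_open[OF A V(1)] chart_open[OF B V'(1)])
  have oi: "open (\<phi> ` O1)" by (rule chart_open_image[OF A V(1) oO(1)]) (use oO in auto)
  define \<Phi> where "\<Phi> = (\<lambda>y. K (inv_into V \<phi> (fst y)) (inv_into V' \<psi> (snd y)))"
  define S where "S = map_prod \<phi> \<psi> ` (N \<inter> V \<times> V')"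
  note ch = smooth_manifold.chart[OF A V(1)] smooth_manifold.chart[OF B V'(1)]
  note pc = product_chartI[OF V(1) V'(1)]
  have oS: "open S" unfolding S_def
    by (rule chart_open_image[OF AB pc]) (use chart_open[OF AB pc] smooth_map_on_open[OF K] in auto)
  have "smooth_on S ((\<lambda>(p, q). K p q) \<circ> inv_into (V \<times> V') (map_prod \<phi> \<psi>))"
    using K pc by (simp add: S_def smooth_fun_iff[OF AB])
  then have sPhi: "smooth_on S \<Phi>"
  proof (rule smooth_on_cong_imp[OF _ oS])
    fix x assume "x \<in> S"
    then have "fst x \<in> \<phi> ` V" "snd x \<in> \<psi> ` V'" by (auto simp: S_def)
    then have "inv_into (V \<times> V') (map_prod \<phi> \<psi>) x = (inv_into V \<phi> (fst x), inv_into V' \<psi> (snd x))"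
      using ch inv_into_map_prod[of \<phi> V \<psi> V' "fst x" "snd x"] by simp
    then show "((\<lambda>(p, q). K p q) \<circ> inv_into (V \<times> V') (map_prod \<phi> \<psi>)) x = \<Phi> x" by (simp add: \<Phi>_def)
  qed
  define w where "w q = (\<Sum>b\<in>E. Z q (\<lambda>r. \<psi> r \<bullet> b) *\<^sub>R b)" for q
  have mem: "(\<phi> q, \<psi> (F q)) \<in> S" if "q \<in> O1" for q
    using N[of q] that oO by (auto simp: S_def)
  \<comment> \<open>The direction \<open>(0, w q)\<close> expresses that the parameter of
    \<open>K\<close> is held at \<open>q\<close> while \<open>Z q\<close> differentiates in the
    other variable.\<close>
  have *: "Z q (K q) = frechet_derivative \<Phi> (at (\<phi> q, \<psi> (F q))) (0, w q)" if q: "q \<in> O1" for q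
  proof -
    have qU: "q \<in> U" "q \<in> V" "F q \<in> V'" using q oO by auto
    have Zq: "Z q = coord_vector B V' \<psi> (F q) (w q)"
      unfolding w_def by (rule tangent_expand[OF B V'(1) qU(3) field_alongD(2)[OF Z qU(1)] E])
    \<comment> \<open>Restricting the joint function to the slice through \<open>q\<close> shows
      that \<open>K q\<close> is smooth near \<open>F q\<close>, so \<open>Z q\<close> does not take
      its default value on it.\<close>
    have "smooth_map_on B (product_atlas A B) UNIV (\<lambda>r. (q, r))"
      by (intro smooth_map_on_Pair[OF B A B] smooth_map_on_const[OF B A] smooth_map_on_id[OF B]) auto
    from smooth_map_on_compose[OF B AB std_atlas_manifold this K]
    have "smooth_near B (F q) (K q)" unfolding smooth_near_def using N[OF qU(1)]
      by (intro exI[of _ "(\<lambda>r. (q, r)) -` N"]) simp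
    then have 1: "Z q (K q) = frechet_derivative (K q \<circ> inv_into V' \<psi>) (at (\<psi> (F q))) (w q)"
      by (simp add: Zq coord_vector_def)
    have 2: "K q \<circ> inv_into V' \<psi> = \<Phi> \<circ> (\<lambda>t. (\<phi> q, t))"
      using chart_inv[OF A V(1) qU(2)] by (simp add: \<Phi>_def comp_def)
    have "(\<Phi> has_derivative frechet_derivative \<Phi> (at (\<phi> q, \<psi> (F q)))) (at (\<phi> q, \<psi> (F q)))"
      using smooth_on_differentiable[OF sPhi mem[OF q]] by (simp add: frechet_derivative_works)
    moreover have "((\<lambda>t. (\<phi> q, t)) has_derivative (\<lambda>t. (0, t))) (at (\<psi> (F q)))"
      by (intro has_derivative_Pair has_derivative_const has_derivative_ident)
    ultimately have "(\<Phi> \<circ> (\<lambda>t. (\<phi> q, t)) has_derivative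
        frechet_derivative \<Phi> (at (\<phi> q, \<psi> (F q))) \<circ> (\<lambda>t. (0, t))) (at (\<psi> (F q)))"
      by (intro diff_chain_at) auto
    from frechet_derivative_at[OF this] show ?thesis unfolding 1 2 by (metis comp_apply)
  qed
  have s1: "smooth_on (\<phi> ` O1) (\<psi> \<circ> F \<circ> inv_into V \<phi>)"
    by (rule smooth_map_onD[OF F V(1) V'(1)]) (use oO in auto)
  have "smooth_on (\<phi> ` O1) (\<lambda>x. \<Sum>b\<in>E. ((\<lambda>p. Z p (\<lambda>r. \<psi> r \<bullet> b)) \<circ> inv_into V \<phi>) x *\<^sub>R b)"
  proof (intro smooth_on_sum[OF oi] smooth_on_scaleR[OF oi] smooth_on_const)
    fix b
    have "smooth_fun A (U \<inter> F -` V') (\<lambda>p. Z p (\<lambda>r. \<psi> r \<bullet> b))"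
      by (rule field_alongD(3)[OF Z smooth_fun_chart_inner[OF B V'(1)]])
    then show "smooth_on (\<phi> ` O1) ((\<lambda>p. Z p (\<lambda>r. \<psi> r \<bullet> b)) \<circ> inv_into V \<phi>)"
      using V by (simp add: smooth_fun_iff[OF A] O1_def)
  qed
  then have s2: "smooth_on (\<phi> ` O1) (\<lambda>x. w (inv_into V \<phi> x))"
    by (simp add: w_def)
  have "smooth_on (\<phi> ` O1) (\<lambda>x. frechet_derivative \<Phi> (at (x, (\<psi> \<circ> F \<circ> inv_into V \<phi>) x)) (0, w (inv_into V \<phi> x)))"
  proof (rule smooth_on_frechet_compose[OF fin_dim_prod[OF smooth_manifold_fin_dim[OF A] smooth_manifold_fin_dim[OF B]] oi _ _ sPhi])
    show "smooth_on (\<phi> ` O1) (\<lambda>x. (x, (\<psi> \<circ> F \<circ> inv_into V \<phi>) x))"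
      by (intro smooth_on_Pair smooth_manifold_fin_dim[OF A] smooth_manifold_fin_dim[OF B] oi s1
        smooth_on_bounded_linear bounded_linear_ident)
    show "smooth_on (\<phi> ` O1) (\<lambda>x. (0 :: 'a, w (inv_into V \<phi> x)))"
      by (rule smooth_on_Pair[OF smooth_manifold_fin_dim[OF A] smooth_manifold_fin_dim[OF B] oi smooth_on_const s2])
    show "(\<lambda>x. (x, (\<psi> \<circ> F \<circ> inv_into V \<phi>) x)) ` \<phi> ` O1 \<subseteq> S"
      using mem oO chart_inv[OF A V(1)] by auto
  qed
  then have "smooth_on (\<phi> ` O1) ((\<lambda>p. Z p (K p)) \<circ> inv_into V \<phi>)"
    by (rule smooth_on_cong_imp[OF _ oi]) (use * oO chart_inv[OF A V(1)] in auto)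
  then show "\<exists>V \<phi> N. (V, \<phi>) \<in> A \<and> open N \<and> p \<in> N \<and> N \<subseteq> U \<inter> V \<and>
      smooth_on (\<phi> ` N) ((\<lambda>p. Z p (K p)) \<circ> inv_into V \<phi>)"
    using V oO by (intro exI[of _ V] exI[of _ \<phi>] exI[of _ O1]) auto
qed

section \<open>Local orthonormal frames\<close>

lemma coord_vector_add_scale:
  fixes A :: "('m::{t2_space,second_countable_topology}, 'a::real_inner) atlas"
  assumes A: "smooth_manifold A" and U: "(U, \<phi>) \<in> A" "p \<in> U"
  shows "coord_vector A U \<phi> p (a *\<^sub>R w + b *\<^sub>R w') =
    (\<lambda>f. a * coord_vector A U \<phi> p w f + b * coord_vector A U \<phi> p w' f)"
  using coord_vector_sum[OF A U, where I = "{True, False}" and c = "\<lambda>x. if x then a else b"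
      and w = "\<lambda>x. if x then w else w'"]
  by simp

lemma card_onb:
  assumes "onb (E :: 'a::real_inner set)"
  shows "card E = dim (UNIV :: 'a set)"
proof -
  have "pairwise orthogonal E" "0 \<notin> E"
    using assms by (force simp: onb_def pairwise_def orthogonal_def)+
  then have "independent E" by (rule pairwise_orthogonal_independent)
  then show ?thesis using dim_eq_card[of E UNIV] assms by (simp add: onb_def)
qed

lemma (in riemannian_manifold) metric_sum:
  assumes v: "\<And>i. i \<in> I \<Longrightarrow> v i \<in> tangent_space A p" and w: "w \<in> tangent_space A p" and I: "finite I"
  shows "g p (\<lambda>f. \<Sum>i\<in>I. c i * v i f) w = (\<Sum>i\<in>I. c i * g p (v i) w)"
  using I v
proof (induction I)
  case empty
  show ?case using scale[OF w w, of 0] by simp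
next
  case (insert i I)
  have "g p (\<lambda>f. c i * v i f + (\<Sum>i\<in>I. c i * v i f)) w = g p (\<lambda>f. c i * v i f) w + g p (\<lambda>f. \<Sum>i\<in>I. c i * v i f) w"
    using insert.prems
    by (intro add w tangent_scale[OF smooth_manifold_axioms] tangent_sum[OF smooth_manifold_axioms]) auto
  then show ?case using insert by (simp add: scale w)
qed

text \<open>Gram--Schmidt applied to the coordinate fields of a chart.  The vectors \<open>w i q\<close> represent the
  fields already constructed in coordinates; orthogonality to the basis vectors not yet used says that
  they lie in the span of the first \<open>k\<close> ones, so that the next coordinate field is independent
  of them.\<close>

lemma (in riemannian_manifold) gram_schmidt:
  fixes b :: "nat \<Rightarrow> 'a"
  assumes U: "(U, \<phi>) \<in> A"
    and b: "\<And>i j. i < n \<Longrightarrow> j < n \<Longrightarrow> b i \<bullet> b j = (if i = j then 1 else 0)"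
  shows "k \<le> n \<Longrightarrow> \<exists>e w. (\<forall>i<k. vector_field A U (e i)) \<and>
    (\<forall>q\<in>U. \<forall>i<k. e i q = coord_vector A U \<phi> q (w i q) \<and> (\<forall>j\<in>{k..<n}. w i q \<bullet> b j = 0)) \<and>
    (\<forall>q\<in>U. \<forall>i<k. \<forall>j<k. g q (e i q) (e j q) = (if i = j then 1 else 0))"
proof (induction k)
  case 0
  show ?case by simp
next
  case (Suc k)
  then obtain e w where *: "\<forall>i<k. vector_field A U (e i)"
    "\<forall>q\<in>U. \<forall>i<k. e i q = coord_vector A U \<phi> q (w i q) \<and> (\<forall>j\<in>{k..<n}. w i q \<bullet> b j = 0)"
    "\<forall>q\<in>U. \<forall>i<k. \<forall>j<k. g q (e i q) (e j q) = (if i = j then 1 else 0)"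
    by (metis Suc_leD)
  have e: "vector_field A U (e i)" if "i < k" for i using * that by blast
  have ew: "e i q = coord_vector A U \<phi> q (w i q)" if "q \<in> U" "i < k" for q i using * that by blast
  have wb: "w i q \<bullet> b j = 0" if "q \<in> U" "i < k" "j \<in> {k..<n}" for q i j using * that by blast
  have on: "g q (e i q) (e j q) = (if i = j then 1 else 0)" if "q \<in> U" "i < k" "j < k" for q i j
    using * that by blast
  note M = smooth_manifold_axioms
  have k: "k < n" using Suc.prems by simp
  have oU: "open U" by (rule chart_open[OF M U])
  define X where "X q = coord_vector A U \<phi> q (b k)" for q
  \<comment> \<open>Minus the projection coefficient, so that \<open>Y\<close> is \<open>X\<close>
    without its components along the earlier fields. The factors \<open>- 1 *\<close> and
    \<open>1 *\<^sub>R\<close>, and later the summand \<open>0 *\<^sub>R 0\<close>, give the terms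
    the shapes of \<open>smooth_fun_mult\<close> and \<open>coord_vector_add_scale\<close>.\<close>
  define c where "c i q = - 1 * g q (X q) (e i q)" for i q
  define s where "s q = 1 *\<^sub>R b k + 1 *\<^sub>R (\<Sum>i<k. c i q *\<^sub>R w i q)" for q
  define Y where "Y q f = X q f + (\<Sum>i<k. c i q * e i q f)" for q f
  \<comment> \<open>The reciprocal length of \<open>Y q\<close>; it is smooth since the squared
    length is positive on \<open>U\<close>.\<close>
  define r where "r q = g q (Y q) (Y q) powr (- 1 / 2)" for q
  define e' where "e' i = (if i = k then (\<lambda>q f. r q * Y q f) else e i)" for i
  define w' where "w' i = (if i = k then (\<lambda>q. r q *\<^sub>R s q + 0 *\<^sub>R 0) else w i)" for i
  have X: "vector_field A U X" unfolding X_def by (rule coord_vector_field[OF M U])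
  have cs: "smooth_fun A U (c i)" if "i < k" for i
    unfolding c_def by (intro smooth_fun_mult[OF M] smooth_fun_const[OF M oU] smooth X e that)
  have Y: "vector_field A U Y" unfolding Y_def
    by (intro field_along_add[OF M M _ X] field_along_sum[OF M M oU] cs e) (auto intro: continuous_on_id)
  have tan: "X q \<in> tangent_space A q" "Y q \<in> tangent_space A q" "i < k \<Longrightarrow> e i q \<in> tangent_space A q"
    "(\<lambda>f. \<Sum>i<k. c i q * e i q f) \<in> tangent_space A q" if "q \<in> U" for q i
    using field_alongD(2)[OF X that] field_alongD(2)[OF Y that] field_alongD(2)[OF e that]
    by (auto intro!: tangent_sum[OF M])
  have Ys: "Y q = coord_vector A U \<phi> q (s q)" if "q \<in> U" for q
    unfolding s_def coord_vector_add_scale[OF M U that] coord_vector_sum[OF M U that]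
    using ew[OF that] by (simp add: Y_def[abs_def] X_def)
  \<comment> \<open>The earlier \<open>w i q\<close> are orthogonal to \<open>b k\<close>, so adding
    multiples of them leaves the \<open>b k\<close>-component of \<open>s q\<close> equal to 1. This
    excludes \<open>s q = 0\<close> below.\<close>
  have sb: "s q \<bullet> b j = (if j = k then 1 else 0)" if "q \<in> U" "j \<in> {k..<n}" for q j
    using that wb[of q _ j] b[of k j] k by (auto simp: s_def inner_add_left inner_sum_left)
  have Ypos: "g q (Y q) (Y q) > 0" if "q \<in> U" for q
  proof (rule pos)
    show "Y q \<in> tangent_space A q" using tan(2)[OF that] .
    show "Y q \<noteq> (\<lambda>_. 0)"
    proof
      assume "Y q = (\<lambda>_. 0)"
      then have "s q = 0" using coord_vector_inj[OF M U that] Ys[OF that] by simp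
      then show False using sb[OF that, of k] k by simp
    qed
  qed
  have rY: "r q * (r q * g q (Y q) (Y q)) = 1" if "q \<in> U" for q
  proof -
    have "r q * r q = inverse (g q (Y q) (Y q))"
      unfolding r_def powr_add[symmetric] using Ypos[OF that] by (simp add: powr_minus)
    then show ?thesis using Ypos[OF that] by (simp flip: mult.assoc)
  qed
  have Ye: "g q (Y q) (e j q) = 0" if q: "q \<in> U" and j: "j < k" for q j
  proof -
    have "g q (Y q) (e j q) = g q (X q) (e j q) + g q (\<lambda>f. \<Sum>i<k. c i q * e i q f) (e j q)"
      unfolding Y_def[abs_def] by (rule add) (use tan[OF q] j in auto)
    also have "g q (\<lambda>f. \<Sum>i<k. c i q * e i q f) (e j q) = (\<Sum>i<k. c i q * g q (e i q) (e j q))"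
      by (rule metric_sum) (use tan[OF q] j in auto)
    also have "\<dots> = (\<Sum>i<k. if i = j then c i q else 0)"
      by (intro sum.cong) (auto simp: on q j)
    also have "\<dots> = c j q" using j by simp
    finally show ?thesis by (simp add: c_def)
  qed
  have rs: "smooth_fun A U r" unfolding r_def
    by (rule smooth_fun_lift[OF M smooth[OF Y Y] smooth_on_powr]) (use Ypos in auto)
  have 1: "vector_field A U (e' i)" if "i < Suc k" for i
    using that e field_along_scale[OF M M _ rs Y] by (auto simp: e'_def continuous_on_id less_Suc_eq)
  have 2: "e' i q = coord_vector A U \<phi> q (w' i q)" if "q \<in> U" "i < Suc k" for i q
  proof (cases "i = k")
    case True
    have "coord_vector A U \<phi> q (r q *\<^sub>R s q + 0 *\<^sub>R 0) = (\<lambda>f. r q * Y q f)"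
      unfolding coord_vector_add_scale[OF M U that(1)] by (simp add: Ys[OF that(1)])
    then show ?thesis using True by (simp add: e'_def w'_def)
  next
    case False
    then show ?thesis using that ew by (simp add: e'_def w'_def)
  qed
  have 3: "w' i q \<bullet> b j = 0" if "q \<in> U" "i < Suc k" "j \<in> {Suc k..<n}" for i q j
    using that wb sb by (auto simp: w'_def less_Suc_eq)
  have kk: "g q (e' k q) (e' k q) = 1" if "q \<in> U" for q
  proof -
    have t: "(\<lambda>f. r q * Y q f) \<in> tangent_space A q" by (rule tangent_scale[OF M tan(2)[OF that]])
    have "g q (e' k q) (e' k q) = r q * g q (Y q) (\<lambda>f. r q * Y q f)"
      unfolding e'_def by (simp add: scale[OF tan(2)[OF that] t])
    also have "g q (Y q) (\<lambda>f. r q * Y q f) = r q * g q (Y q) (Y q)"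
      by (simp add: sym[OF tan(2)[OF that] t] scale[OF tan(2)[OF that] tan(2)[OF that]])
    finally show ?thesis using rY[OF that] by simp
  qed
  have kj: "g q (e' k q) (e' j q) = 0" "g q (e' j q) (e' k q) = 0" if "q \<in> U" "j < k" for q j
  proof -
    have t: "(\<lambda>f. r q * Y q f) \<in> tangent_space A q" by (rule tangent_scale[OF M tan(2)[OF that(1)]])
    have ej: "e' j q = e j q" using that by (simp add: e'_def)
    show *: "g q (e' k q) (e' j q) = 0"
      unfolding ej using that by (simp add: e'_def scale tan Ye)
    show "g q (e' j q) (e' k q) = 0"
      using * sym[of "e' j q" q "e' k q"] t tan(3)[OF that] unfolding ej by (simp add: e'_def)
  qed
  have 4: "g q (e' i q) (e' j q) = (if i = j then 1 else 0)" if "q \<in> U" "i < Suc k" "j < Suc k" for i j q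
  proof (cases "i = k \<or> j = k")
    case True
    then show ?thesis using that kk kj by (auto simp: less_Suc_eq)
  next
    case False
    then show ?thesis using that on by (auto simp: less_Suc_eq e'_def)
  qed
  show ?case using 1 2 3 4 by (intro exI[of _ e'] exI[of _ w']) blast
qed

lemma (in riemannian_manifold) orthonormal_frame_exists:
  "\<exists>e U. open U \<and> p \<in> U \<and> orthonormal_frame A g U e"
proof -
  note M = smooth_manifold_axioms
  obtain U \<phi> where U: "(U, \<phi>) \<in> A" "p \<in> U" using chart_at[OF M] .
  obtain E :: "'a set" where E: "onb E" using onb_exists[OF smooth_manifold_fin_dim[OF M]] .
  obtain b where b: "bij_betw b {..<dim (UNIV :: 'a set)} E"
    using ex_bij_betw_nat_finite[OF onb_finite[OF E]] card_onb[OF E] by (auto simp: atLeast0LessThan)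
  have "b i \<bullet> b j = (if i = j then 1 else 0)" if "i < dim (UNIV :: 'a set)" "j < dim (UNIV :: 'a set)" for i j
    using E b that by (auto simp: onb_def bij_betw_def inj_on_def)
  from gram_schmidt[OF U(1) this order_refl] obtain e where
    "orthonormal_frame A g U e" unfolding orthonormal_frame_def by blast
  then show ?thesis using U chart_open[OF M U(1)] by blast
qed

text \<open>Existence turns the choice in \<open>frame_near\<close> into a frame with the defining
  properties.\<close>

lemma (in riemannian_manifold) frame_near_orthonormal:
  obtains U where "open U" "p \<in> U" "orthonormal_frame A g U (frame_near A g p)"
  using someI_ex[OF orthonormal_frame_exists[of p]] unfolding frame_near_def by blast

section \<open>Connections and Lie groups\<close>

lemma connection_along_sum:
  fixes A :: "('m::{t2_space,second_countable_topology}, 'a::real_inner) atlas"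
    and B :: "('n::{t2_space,second_countable_topology}, 'b::real_inner) atlas"
  assumes D: "connection_along A B F D"
    and A: "smooth_manifold A" and B: "smooth_manifold B" and F: "continuous_on U F"
    and X: "vector_field A U X" and p: "p \<in> U" and I: "finite I"
    and u: "\<And>i. i \<in> I \<Longrightarrow> smooth_fun A U (u i)" and Z: "\<And>i. i \<in> I \<Longrightarrow> field_along A B F U (Z i)"
  shows "D X (\<lambda>q f. \<Sum>i\<in>I. u i q * Z i q f) p = (\<lambda>f. \<Sum>i\<in>I. X p (u i) * Z i p f + u i p * D X (Z i) p f)"
  using I u Z
proof (induction I)
  case empty
  have oU: "open U" using X by (rule field_alongD)
  have "field_along A B F U (\<lambda>q f. 0)"
    using field_along_sum[OF A B oU F, of "{}"] by simp
  \<comment> \<open>The zero section is 0 times itself, so the Leibniz rule with coefficient 0 gives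
    its derivative.\<close>
  from connection_along.leibniz[OF D X this smooth_fun_const[OF A oU, of 0] p] show ?case
    using tangent_const[OF A] field_alongD(2)[OF X p] by simp
next
  case (insert i I)
  have oU: "open U" using X by (rule field_alongD)
  have "field_along A B F U (\<lambda>q f. \<Sum>i\<in>I. u i q * Z i q f)"
    using insert by (intro field_along_sum[OF A B oU F]) auto
  moreover have "field_along A B F U (\<lambda>q f. u i q * Z i q f)"
    using insert by (intro field_along_scale[OF A B F]) auto
  ultimately have "D X (\<lambda>q f. u i q * Z i q f + (\<Sum>i\<in>I. u i q * Z i q f)) p =
      (\<lambda>f. D X (\<lambda>q f. u i q * Z i q f) p f + D X (\<lambda>q f. \<Sum>i\<in>I. u i q * Z i q f) p f)"
    by (intro connection_along.add_right[OF D X _ _ p])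
  moreover have "D X (\<lambda>q f. u i q * Z i q f) p = (\<lambda>f. X p (u i) * Z i p f + u i p * D X (Z i) p f)"
    using insert by (intro connection_along.leibniz[OF D X _ _ p]) auto
  ultimately show ?case using insert by simp
qed

section \<open>Left invariant fields and the Maurer-Cartan form\<close>

context lie_group
begin

abbreviation invariant_field :: "'n tvec \<Rightarrow> 'n \<Rightarrow> 'n tvec" where
  "invariant_field \<equiv> left_invariant_field B mul one"

lemma smooth_translation: "smooth_map_on B B UNIV (mul h)"
proof -
  note M = smooth_manifold_axioms
  have "smooth_map_on B (product_atlas B B) UNIV (\<lambda>k. (h, k))"
    by (intro smooth_map_on_Pair[OF M M M] smooth_map_on_const[OF M M] smooth_map_on_id[OF M]) auto
  from smooth_map_on_compose[OF M product_atlas_manifold[OF M M] M this smooth_mul]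
  show ?thesis by simp
qed

lemma invariant_field_tangent:
  "x \<in> tangent_space B one \<Longrightarrow> invariant_field x h \<in> tangent_space B h"
  using pushforward_tangent[OF smooth_manifold_axioms smooth_manifold_axioms smooth_translation[of h], of one x]
  by (simp add: left_invariant_field_def)

lemma invariant_field_smooth:
  assumes x: "x \<in> tangent_space B one"
  shows "vector_field B UNIV (invariant_field x)"
  unfolding field_along_def
proof (intro conjI ballI allI impI)
  note M = smooth_manifold_axioms
  show "invariant_field x h \<in> tangent_space B (id h)" for h
    using invariant_field_tangent[OF x] by simp
  fix W and f :: "'n \<Rightarrow> real" assume f: "smooth_fun B W f"
  have oW: "open W" using f by (rule smooth_map_on_open)
  have "smooth_fun B W (\<lambda>h. x (\<lambda>k. f (mul h k)))"
  \<comment> \<open>Here \<open>x\<close> is regarded as a constant field along the constant map to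
    the identity, and the group element \<open>h\<close> is the parameter of the function being
    differentiated.\<close>
  proof (rule smooth_fun_field_apply[OF M M, where Z = "\<lambda>_. x" and F = "\<lambda>_. one" and K = "\<lambda>h k. f (mul h k)"])
    show "field_along B B (\<lambda>_. one) W (\<lambda>_. x)"
      unfolding field_along_def
    proof (intro conjI ballI allI impI oW x)
      show "smooth_fun B (W \<inter> (\<lambda>_. one) -` W') (\<lambda>p. x f')" for W' f'
        by (rule smooth_fun_const[OF M]) (use oW in \<open>auto simp: vimage_def\<close>)
    qed
    show "smooth_map_on B B W (\<lambda>_. one)" by (rule smooth_map_on_const[OF M M oW])
    show "smooth_fun (product_atlas B B) ((\<lambda>(h, k). mul h k) -` W) (\<lambda>(h, k). f (mul h k))"
      using smooth_map_on_compose[OF product_atlas_manifold[OF M M] M std_atlas_manifold smooth_mul f]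
      by (simp add: case_prod_unfold)
  qed simp
  then have "smooth_fun B W (\<lambda>h. invariant_field x h f)"
  proof (rule smooth_map_on_cong[OF M std_atlas_manifold])
    fix h assume "h \<in> W"
    then have "smooth_near B h f" using f by (auto simp: smooth_near_def)
    then show "x (\<lambda>k. f (mul h k)) = invariant_field x h f"
      by (simp add: left_invariant_field_def pushforward_def comp_def)
  qed
  then show "smooth_fun B (UNIV \<inter> id -` W) (\<lambda>h. invariant_field x h f)" by simp
qed simp

text \<open>Chain rule for translation by \<open>h\<close> after translation by
  \<open>h^{-1} k\<close>, which is translation by \<open>k\<close>.\<close>

lemma left_translate_invariant_field:
  "left_translate B mul iv h (invariant_field x) = invariant_field x"
proof
  fix k
  note M = smooth_manifold_axioms
  have "pushforward B (mul h) (mul (mul (iv h) k) one) (pushforward B (mul (mul (iv h) k)) one x) =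
      pushforward B (\<lambda>q. mul h (mul (mul (iv h) k) q)) one x"
    by (rule pushforward_pushforward[OF M M smooth_translation]) simp
  then show "left_translate B mul iv h (invariant_field x) k = invariant_field x k"
    by (simp add: left_translate_def left_invariant_field_def flip: assoc)
qed

lemma maurer_cartan_tangent:
  assumes "v \<in> tangent_space B h"
  shows "maurer_cartan B mul iv h v \<in> tangent_space B one"
  using pushforward_tangent[OF smooth_manifold_axioms smooth_manifold_axioms smooth_translation[of "iv h"] _ assms]
  by (simp add: maurer_cartan_def)

lemma invariant_field_maurer_cartan:
  assumes "v \<in> tangent_space B h"
  shows "invariant_field (maurer_cartan B mul iv h v) h = v"
proof -
  note M = smooth_manifold_axioms
  have "pushforward B (mul h) (mul (iv h) h) (pushforward B (mul (iv h)) h v) =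
      pushforward B (\<lambda>q. mul h (mul (iv h) q)) h v"
    by (rule pushforward_pushforward[OF M M smooth_translation]) simp
  then show ?thesis using pushforward_ident[OF assms]
    by (simp add: maurer_cartan_def left_invariant_field_def flip: assoc)
qed

text \<open>With \<open>invariant_field_maurer_cartan\<close>, left translation is a bijection
  between the Lie algebra and each tangent space. This direction later recovers an element of the
  Lie algebra from its translate.\<close>

lemma maurer_cartan_invariant_field:
  assumes "x \<in> tangent_space B one"
  shows "maurer_cartan B mul iv h (invariant_field x h) = x"
proof -
  note M = smooth_manifold_axioms
  have "pushforward B (mul (iv h)) (mul h one) (pushforward B (mul h) one x) =
      pushforward B (\<lambda>q. mul (iv h) (mul h q)) one x"
    by (rule pushforward_pushforward[OF M M smooth_translation]) simp
  then show ?thesis using pushforward_ident[OF assms]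
    by (simp add: maurer_cartan_def left_invariant_field_def flip: assoc)
qed

lemma invariant_field_sum:
  "invariant_field (\<lambda>f. \<Sum>i\<in>I. c i * x i f) h = (\<lambda>f. \<Sum>i\<in>I. c i * invariant_field (x i) h f)"
  by (simp add: left_invariant_field_def pushforward_sum)

text \<open>Skew-symmetry makes \<alpha>(x, x) its own negative, hence 0 at the identity; left
  invariance carries this to every \<open>h\<close>.\<close>

lemma connection_invariant_diagonal:
  assumes C: "left_invariant_connection B mul iv nabla"
    and skew: "connection_function B mul one nabla x x = (\<lambda>f. - connection_function B mul one nabla x x f)"
    and x: "x \<in> tangent_space B one"
  shows "nabla (invariant_field x) (invariant_field x) h = (\<lambda>_. 0)"
proof -
  note E = invariant_field_smooth[OF x]
  have "nabla (invariant_field x) (invariant_field x) one f = 0" for f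
    using fun_cong[OF skew, of f] by (simp add: connection_function_def)
  then have 0: "nabla (invariant_field x) (invariant_field x) one = (\<lambda>_. 0)" by blast
  have "nabla (invariant_field x) (invariant_field x) h = pushforward B (mul h) one (nabla (invariant_field x) (invariant_field x) one)"
    using left_invariant_connection.left_invariant[OF C E E UNIV_I, of h one]
    by (simp add: left_translate_invariant_field)
  then show ?thesis by (simp add: 0 pushforward_def)
qed

text \<open>The value at \<open>q\<close> is the derivative along \<open>X q\<close> of
  \<open>f (mul (iv (F q)) (F r))\<close> in the variable \<open>r\<close> at \<open>r = q\<close>.
  On the diagonal the argument of \<open>f\<close> is the identity, so smoothness of
  \<open>f\<close> near the identity is enough.\<close>

lemma smooth_fun_maurer_cartan:
  fixes A :: "('m::{t2_space,second_countable_topology}, 'c::real_inner) atlas"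
  assumes A: "smooth_manifold A" and F: "smooth_map_on A B UNIV F" and X: "vector_field A U X"
    and f: "smooth_near B one f"
  shows "smooth_fun A U (\<lambda>q. pullback_form B F (maurer_cartan B mul iv) q (X q) f)"
proof -
  note M = smooth_manifold_axioms
  obtain W where W: "one \<in> W" "smooth_fun B W f" using f by (auto simp: smooth_near_def)
  note AA = product_atlas_manifold[OF A A] and MM = product_atlas_manifold[OF M M]
  have id: "vector_field A U X \<longleftrightarrow> field_along A A (\<lambda>p. p) U X" by (simp add: id_def)
  have Ff: "smooth_map_on (product_atlas A A) B UNIV (\<lambda>z. F (fst z))"
    and Fs: "smooth_map_on (product_atlas A A) B UNIV (\<lambda>z. F (snd z))"
    using smooth_map_on_compose[OF AA A M smooth_map_on_fst[OF A A] F]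
      smooth_map_on_compose[OF AA A M smooth_map_on_snd[OF A A] F] by simp_all
  have "smooth_map_on (product_atlas A A) B UNIV (\<lambda>z. iv (F (fst z)))"
    using smooth_map_on_compose[OF AA M M Ff smooth_iv] by simp
  from smooth_map_on_compose[OF AA MM M smooth_map_on_Pair[OF AA M M this Fs] smooth_mul]
  have G: "smooth_map_on (product_atlas A A) B UNIV (\<lambda>z. mul (iv (F (fst z))) (F (snd z)))" by simp
  have "smooth_fun A U (\<lambda>q. X q ((\<lambda>q r. f (mul (iv (F q)) (F r))) q))"
  proof (rule smooth_fun_field_apply[OF A A X[unfolded id] smooth_map_on_id[OF A field_alongD(1)[OF X]]])
    show "smooth_fun (product_atlas A A) ((\<lambda>z. mul (iv (F (fst z))) (F (snd z))) -` W)
        (\<lambda>(q, r). f (mul (iv (F q)) (F r)))"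
      using smooth_map_on_compose[OF AA M std_atlas_manifold G W(2)] by (simp add: case_prod_unfold)
  qed (use W in simp)
  moreover have "pullback_form B F (maurer_cartan B mul iv) q (X q) f = X q (\<lambda>r. f (mul (iv (F q)) (F r)))" for q
  proof -
    \<comment> \<open>The form is a push-forward of a push-forward, each with its own default case;
      this settles the one at the identity, and the next fact the one at \<open>F q\<close>.\<close>
    have 1: "smooth_near B (mul (iv (F q)) (F q)) f" using f by simp
    have "smooth_near B (F q) (\<lambda>k. f (mul (iv (F q)) k))"
      by (rule smooth_near_compose[OF M M smooth_translation UNIV_I 1])
    then show ?thesis using f by (simp add: pullback_form_def maurer_cartan_def pushforward_def comp_def)
  qed
  ultimately show ?thesis by simp
qed

lemma pullback_maurer_cartan_tangent:
  fixes A :: "('m::{t2_space,second_countable_topology}, 'c::real_inner) atlas"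
  assumes A: "smooth_manifold A" and F: "smooth_map_on A B UNIV F" and v: "v \<in> tangent_space A p"
  shows "pullback_form B F (maurer_cartan B mul iv) p v \<in> tangent_space B one"
    "invariant_field (pullback_form B F (maurer_cartan B mul iv) p v) (F p) = pushforward B F p v"
  using pushforward_tangent[OF A smooth_manifold_axioms F UNIV_I v]
  by (simp_all add: pullback_form_def maurer_cartan_tangent invariant_field_maurer_cartan)

text \<open>Expanding \<open>F\<^sub>*X\<close> in a left invariant frame, the terms of the Leibniz rule that involve the
  connection add up to \<open>\<nabla>\<^sub>E E\<close> for the left invariant field \<open>E\<close> that extends \<open>F\<^sub>*(X p)\<close>, and this
  vanishes by skew-symmetry.\<close>

lemma pullback_connection_pushforward:
  fixes A :: "('m::{t2_space,second_countable_topology}, 'c::real_inner) atlas"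
    and D :: "('m \<Rightarrow> 'm tvec) \<Rightarrow> ('m \<Rightarrow> 'n tvec) \<Rightarrow> 'm \<Rightarrow> 'n tvec"
  assumes A: "smooth_manifold A" and F: "smooth_map_on A B UNIV F" and X: "vector_field A U X" and p: "p \<in> U"
    and C: "left_invariant_connection B mul iv nabla" and D: "pullback_connection A B F D nabla"
    and skew: "\<And>x. x \<in> tangent_space B one \<Longrightarrow>
      connection_function B mul one nabla x x = (\<lambda>f. - connection_function B mul one nabla x x f)"
  defines "\<omega> \<equiv> \<lambda>q. pullback_form B F (maurer_cartan B mul iv) q (X q)"
  shows "(\<lambda>f. X p (\<lambda>q. \<omega> q f)) \<in> tangent_space B one" (is ?tangent)
    and "D X (\<lambda>q. pushforward B F q (X q)) p = invariant_field (\<lambda>f. X p (\<lambda>q. \<omega> q f)) (F p)" (is ?eq)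
proof -
  note M = smooth_manifold_axioms
  interpret D: pullback_connection A B F D nabla by (rule D)
  interpret C: left_invariant_connection B mul iv nabla by (rule C)
  have oU: "open U" using X by (rule field_alongD)
  have cF: "continuous_on U F" using smooth_map_on_continuous[OF F] by (rule continuous_on_subset) simp
  have Xp: "X q \<in> tangent_space A q" if "q \<in> U" for q using field_alongD(2)[OF X that] by simp
  obtain V \<psi> where V: "(V, \<psi>) \<in> B" "one \<in> V" using chart_at[OF M] .
  obtain E :: "'b set" where E: "onb E" using onb_exists[OF smooth_manifold_fin_dim[OF M]] .
  note fE = onb_finite[OF E]
  \<comment> \<open>The coordinate vectors at the identity are a basis of the Lie algebra, and
    \<open>u b\<close> is the component of \<open>\<omega>\<close> along \<open>x b\<close>.\<close>
  define x where "x b = coord_vector B V \<psi> one b" for b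
  define u where "u b q = \<omega> q (\<lambda>r. \<psi> r \<bullet> b)" for b q
  have x: "x b \<in> tangent_space B one" for b unfolding x_def by (rule coord_vector_tangent[OF M V])
  have \<omega>1: "\<omega> q \<in> tangent_space B one" if "q \<in> U" for q
    unfolding \<omega>_def by (rule pullback_maurer_cartan_tangent[OF A F Xp[OF that]])
  have \<omega>: "\<omega> q = (\<lambda>f. \<Sum>b\<in>E. u b q * x b f)" if "q \<in> U" for q
    using tangent_expand[OF M V \<omega>1[OF that] E] by (simp add: u_def x_def coord_vector_sum[OF M V])
  have inv\<omega>: "invariant_field (\<omega> q) (F q) = pushforward B F q (X q)" if "q \<in> U" for q
    unfolding \<omega>_def by (rule pullback_maurer_cartan_tangent[OF A F Xp[OF that]])
  have u: "smooth_fun A U (u b)" for b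
    unfolding u_def \<omega>_def
    by (rule smooth_fun_maurer_cartan[OF A F X]) (use smooth_fun_chart_inner[OF M V(1)] V(2) in \<open>auto simp: smooth_near_def\<close>)
  \<comment> \<open>Differentiation through the functionals \<open>x \<mapsto> x f\<close> agrees
    with differentiation of components. The expansion of \<open>\<omega>\<close> holds on
    \<open>U\<close> only, hence the appeal to locality.\<close>
  have X\<omega>: "(\<lambda>f. X p (\<lambda>q. \<omega> q f)) = (\<lambda>f. \<Sum>b\<in>E. X p (u b) * x b f)"
  proof
    fix f
    have "X p (\<lambda>q. \<omega> q f) = X p (\<lambda>q. \<Sum>b\<in>E. u b q * x b f)"
      by (rule tangent_local[OF A Xp[OF p] oU p]) (simp add: \<omega>)
    also have "\<dots> = (\<Sum>b\<in>E. X p (u b) * x b f)"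
      by (rule tangent_fun_sum[OF A Xp[OF p] u oU p])
    finally show "X p (\<lambda>q. \<omega> q f) = (\<Sum>b\<in>E. X p (u b) * x b f)" .
  qed
  show ?tangent unfolding X\<omega> by (intro tangent_sum[OF M] x)
  let ?L = invariant_field
  have Z: "field_along A B F U (?L (x b) \<circ> F)" for b
    by (rule field_along_compose[OF A M F invariant_field_smooth[OF x] oU])
  \<comment> \<open>The left invariant field with value \<open>F_* (X p)\<close> at
    \<open>F p\<close> has constant coefficients in the frame, namely those of
    \<open>\<omega>\<close> at \<open>p\<close>.\<close>
  have Lp: "?L (\<omega> p) = (\<lambda>h f. \<Sum>b\<in>E. u b p * ?L (x b) h f)"
    by (rule ext) (simp only: \<omega>[OF p] invariant_field_sum)
  have "D X (\<lambda>q. pushforward B F q (X q)) p = D X (\<lambda>q f. \<Sum>b\<in>E. u b q * (?L (x b) \<circ> F) q f) p"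
  proof (rule D.local[OF X _ _ _ p])
    show "field_along A B F U (\<lambda>q f. \<Sum>b\<in>E. u b q * (?L (x b) \<circ> F) q f)"
      by (intro field_along_sum[OF A M oU cF] u Z)
    show "\<forall>q\<in>U. pushforward B F q (X q) = (\<lambda>f. \<Sum>b\<in>E. u b q * (?L (x b) \<circ> F) q f)"
    proof
      fix q assume q: "q \<in> U"
      show "pushforward B F q (X q) = (\<lambda>f. \<Sum>b\<in>E. u b q * (?L (x b) \<circ> F) q f)"
        unfolding inv\<omega>[OF q, symmetric] \<omega>[OF q] invariant_field_sum by simp
    qed
  qed simp
  also have "\<dots> = (\<lambda>f. \<Sum>b\<in>E. X p (u b) * (?L (x b) \<circ> F) p f + u b p * D X (?L (x b) \<circ> F) p f)"
    by (rule connection_along_sum[OF D.connection_along_axioms A M cF X p fE u Z])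
  also have "\<dots> = (\<lambda>f. (\<Sum>b\<in>E. X p (u b) * ?L (x b) (F p) f) + (\<Sum>b\<in>E. u b p * nabla (?L (\<omega> p)) (?L (x b)) (F p) f))"
  proof -
    \<comment> \<open>One extension of \<open>F_* (X p)\<close> serves for every \<open>b\<close>,
      so the connection terms can be collected into a single covariant derivative.\<close>
    have "D X (?L (x b) \<circ> F) p = nabla (?L (\<omega> p)) (?L (x b)) (F p)" for b
      by (rule D.induced[OF X p invariant_field_smooth[OF x] UNIV_I invariant_field_smooth[OF \<omega>1[OF p]] inv\<omega>[OF p]])
    then show ?thesis by (simp add: sum.distrib)
  qed
  also have "\<dots> = (\<lambda>f. \<Sum>b\<in>E. X p (u b) * ?L (x b) (F p) f)"
  proof -
    note Lw = invariant_field_smooth[OF \<omega>1[OF p]]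
    \<comment> \<open>The same expansion on \<open>G\<close>, along the identity map: the
      coefficients are constants, so their derivatives drop out and the sum of connection terms
      remains.\<close>
    have "nabla (?L (\<omega> p)) (\<lambda>h f. \<Sum>b\<in>E. (\<lambda>_. u b p) h * ?L (x b) h f) (F p) =
      (\<lambda>f. \<Sum>b\<in>E. ?L (\<omega> p) (F p) (\<lambda>_. u b p) * ?L (x b) (F p) f + (\<lambda>_. u b p) (F p) * nabla (?L (\<omega> p)) (?L (x b)) (F p) f)"
      by (rule connection_along_sum[OF C.connection_along_axioms M M continuous_on_id' Lw UNIV_I fE smooth_fun_const[OF M open_UNIV] invariant_field_smooth[OF x]])
    then have "nabla (?L (\<omega> p)) (?L (\<omega> p)) (F p) = (\<lambda>f. \<Sum>b\<in>E. u b p * nabla (?L (\<omega> p)) (?L (x b)) (F p) f)"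
      using tangent_const[OF M invariant_field_tangent[OF \<omega>1[OF p]]] by (simp flip: Lp)
    moreover have "nabla (?L (\<omega> p)) (?L (\<omega> p)) (F p) = (\<lambda>_. 0)"
      by (rule connection_invariant_diagonal[OF C skew[OF \<omega>1[OF p]] \<omega>1[OF p]])
    ultimately have "(\<Sum>b\<in>E. u b p * nabla (?L (\<omega> p)) (?L (x b)) (F p) f) = 0" for f by metis
    then show ?thesis by simp
  qed
  finally show ?eq unfolding X\<omega> invariant_field_sum .
qed

end

section \<open>Tension field and co-differential compared in one frame\<close>

theorem theorem3p8:
  fixes A :: "('m::{t2_space,second_countable_topology}, 'a::real_inner) atlas"
    and g :: "'m \<Rightarrow> 'm tvec \<Rightarrow> 'm tvec \<Rightarrow> real"
    and nablaM :: "('m \<Rightarrow> 'm tvec) \<Rightarrow> ('m \<Rightarrow> 'm tvec) \<Rightarrow> 'm \<Rightarrow> 'm tvec"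
    and B :: "('n::{t2_space,second_countable_topology}, 'b::real_inner) atlas"
    and mul :: "'n \<Rightarrow> 'n \<Rightarrow> 'n" and one :: 'n and iv :: "'n \<Rightarrow> 'n"
    and nablaG :: "('n \<Rightarrow> 'n tvec) \<Rightarrow> ('n \<Rightarrow> 'n tvec) \<Rightarrow> 'n \<Rightarrow> 'n tvec"
    and F :: "'m \<Rightarrow> 'n"
    and nablaG' :: "('m \<Rightarrow> 'm tvec) \<Rightarrow> ('m \<Rightarrow> 'n tvec) \<Rightarrow> 'm \<Rightarrow> 'n tvec"
  assumes "riemannian_manifold A g"
    and "levi_civita A g nablaM"
    and "lie_group B mul one iv"
    and "left_invariant_connection B mul iv nablaG"
    and skew: "\<And>x y. x \<in> tangent_space B one \<Longrightarrow> y \<in> tangent_space B one \<Longrightarrow>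
      connection_function B mul one nablaG x y = (\<lambda>f. - connection_function B mul one nablaG y x f)"
    and "smooth_map_on A B UNIV F"
    and "pullback_connection A B F nablaG' nablaG"
  shows "harmonic A B g F nablaM nablaG' \<longleftrightarrow>
    (\<forall>p. codifferential A g nablaM (pullback_form B F (maurer_cartan B mul iv)) p = (\<lambda>_. 0))"
proof -
  interpret M: riemannian_manifold A g by fact
  interpret LC: levi_civita A g nablaM by fact
  interpret G: lie_group B mul one iv by fact
  note MA = M.smooth_manifold_axioms and MB = G.smooth_manifold_axioms
  note F = \<open>smooth_map_on A B UNIV F\<close>
  let ?\<omega> = "pullback_form B F (maurer_cartan B mul iv)"
  have "tension_field A B g F nablaM nablaG' p = (\<lambda>_. 0) \<longleftrightarrow> codifferential A g nablaM ?\<omega> p = (\<lambda>_. 0)" for p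
  proof -
    let ?n = "dim (UNIV :: 'a set)"
    define e where "e = frame_near A g p"
    \<comment> \<open>Minus the co-differential. The factors \<open>1 *\<close> and
      \<open>- 1 *\<close> match \<open>invariant_field_sum\<close> and the closure lemmas for
      tangent vectors.\<close>
    define T where "T f = (\<Sum>i<?n. 1 * (e i p (\<lambda>q. ?\<omega> q (e i q) f) + - 1 * ?\<omega> p (nablaM (e i) (e i) p) f))" for f
    obtain U where U: "p \<in> U" "orthonormal_frame A g U e"
      unfolding e_def using M.frame_near_orthonormal[of p] by blast
    have e: "vector_field A U (e i)" if "i < ?n" for i
      using U that by (simp add: orthonormal_frame_def)
    have ne: "nablaM (e i) (e i) p \<in> tangent_space A p" if "i < ?n" for i
      using field_alongD(2)[OF LC.smooth[OF e e] U(1)] that by simp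
    have sk: "connection_function B mul one nablaG x x = (\<lambda>f. - connection_function B mul one nablaG x x f)"
      if "x \<in> tangent_space B one" for x using skew[OF that that] .
    have key: "(\<lambda>f. e i p (\<lambda>q. ?\<omega> q (e i q) f)) \<in> tangent_space B one"
      "nablaG' (e i) (\<lambda>q. pushforward B F q (e i q)) p = G.invariant_field (\<lambda>f. e i p (\<lambda>q. ?\<omega> q (e i q) f)) (F p)"
      if "i < ?n" for i
      using G.pullback_connection_pushforward[OF MA F e[OF that] U(1)
        \<open>left_invariant_connection B mul iv nablaG\<close> \<open>pullback_connection A B F nablaG' nablaG\<close>] sk by blast+
    have "codifferential A g nablaM ?\<omega> p = (\<lambda>f. - T f)"
      by (simp add: codifferential_def Let_def T_def e_def)
    then have cod: "codifferential A g nablaM ?\<omega> p = (\<lambda>_. 0) \<longleftrightarrow> T = (\<lambda>_. 0)"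
      by (auto simp: fun_eq_iff)
    \<comment> \<open>Both terms are values at \<open>F p\<close> of left invariant fields: the
      first by \<open>key\<close>, the second because \<open>F_*\<close> of a vector is the left
      translate of its Maurer-Cartan value.\<close>
    have "second_fundamental_form B F nablaM nablaG' (e i) (e i) p =
        G.invariant_field (\<lambda>f. e i p (\<lambda>q. ?\<omega> q (e i q) f) + - 1 * ?\<omega> p (nablaM (e i) (e i) p) f) (F p)"
      if "i < ?n" for i
      unfolding second_fundamental_form_def key(2)[OF that]
        G.pullback_maurer_cartan_tangent(2)[OF MA F ne[OF that], symmetric]
      by (auto simp: left_invariant_field_def pushforward_def)
    then have ten: "tension_field A B g F nablaM nablaG' p = G.invariant_field T (F p)"
      unfolding T_def G.invariant_field_sum by (simp add: tension_field_def Let_def e_def[symmetric])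
    have "T \<in> tangent_space B one"
      unfolding T_def
      by (intro tangent_sum[OF MB] tangent_add[OF MB] tangent_scale[OF MB]
          G.pullback_maurer_cartan_tangent(1)[OF MA F ne] key(1)) auto
    \<comment> \<open>The form undoes the translation, so \<open>T\<close> vanishes exactly when its
      translate, the tension field, does; this gives both directions of the equivalence.\<close>
    then have "T = maurer_cartan B mul iv (F p) (G.invariant_field T (F p))"
      by (simp add: G.maurer_cartan_invariant_field)
    moreover have "maurer_cartan B mul iv h (\<lambda>_. 0) = (\<lambda>_. 0)" "G.invariant_field (\<lambda>_. 0) h = (\<lambda>_. 0)" for h
      by (simp_all add: maurer_cartan_def left_invariant_field_def pushforward_def)
    ultimately have "G.invariant_field T (F p) = (\<lambda>_. 0) \<longleftrightarrow> T = (\<lambda>_. 0)" by metis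
    then show ?thesis using cod ten by simp
  qed
  then show ?thesis by (simp add: harmonic_def)
qed

end
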